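(* Let $A$ be a C$^*$-algebra with cancellation. If $A$ has real rank zero and $K_0(A)^+=D_0(A)$, then for all $a,b\in A$ and all $g,h\in K_0(A)^+$, \[ s_{g+h}(ab)\leq s_g(a)\,s_h(b). \]
   Context: For a C$^*$-algebra $A$, $P(A)$ denotes the set of projections of $A$, $K_0(A)$ is the usual $K_0$-group with positive cone $K_0(A)^+=\{[p]_0 : p \text{ a projection in } M_n(A) \text{ for some } n\geq 1\}$, and for $g,h\in K_0(A)$ we write $g\leq h$ if $h-g\in K_0(A)^+$. The dimension range is $D_0(A)=\{[p]_0\mid p\in P(A)\}$. $A$ has cancellation if for all projections $p,q$ in $\bigcup_{n\geq1}M_n(A)$, $[p]_0=[q]_0$ if and only if $p$ and $q$ are Murray--von Neumann equivalent. The singular value function of $a\in A$ is the function $s(a)\colon K_0(A)^+\to[0,\infty)$ defined by \[ s_g(a):=\inf\{\|a-ap\| \mid p\in P(A),\ [p]_0\leq g\},\qquad g\in K_0(A)^+. \] *)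

theory Defs
  imports "HOL-Analysis.Analysis"
begin

definition cstar_algebra ::
  "(complex \<Rightarrow> 'a::{real_normed_algebra,banach} \<Rightarrow> 'a) \<Rightarrow> ('a \<Rightarrow> 'a) \<Rightarrow> bool" where
  "cstar_algebra csc star \<longleftrightarrow>
     (\<forall>x. csc 1 x = x) \<and>
     (\<forall>c d x. csc (c * d) x = csc c (csc d x)) \<and>
     (\<forall>c d x. csc (c + d) x = csc c x + csc d x) \<and>
     (\<forall>c x y. csc c (x + y) = csc c x + csc c y) \<and>
     (\<forall>r x. csc (complex_of_real r) x = r *\<^sub>R x) \<and>
     (\<forall>c x y. csc c (x * y) = csc c x * y \<and> csc c (x * y) = x * csc c y) \<and>
     (\<forall>c x. norm (csc c x) = cmod c * norm x) \<and>
     (\<forall>x. star (star x) = x) \<and>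
     (\<forall>x y. star (x + y) = star x + star y) \<and>
     (\<forall>c x. star (csc c x) = csc (cnj c) (star x)) \<and>
     (\<forall>x y. star (x * y) = star y * star x) \<and>
     (\<forall>x. norm (star x * x) = (norm x)\<^sup>2)"

subsection \<open>The unitization \<open>A~ = A \<oplus> \<complex>\<close> (pairs (a, \<lambda>) standing for a + \<lambda>1)\<close>

definition umult :: "(complex \<Rightarrow> 'a::ring \<Rightarrow> 'a) \<Rightarrow> 'a \<times> complex \<Rightarrow> 'a \<times> complex \<Rightarrow> 'a \<times> complex" where
  "umult csc x y = (fst x * fst y + csc (snd x) (fst y) + csc (snd y) (fst x), snd x * snd y)"

definition ustar :: "('a \<Rightarrow> 'a) \<Rightarrow> 'a \<times> complex \<Rightarrow> 'a \<times> complex" where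
  "ustar star x = (star (fst x), cnj (snd x))"

definition uinvertible :: "(complex \<Rightarrow> 'a::ring \<Rightarrow> 'a) \<Rightarrow> 'a \<times> complex \<Rightarrow> bool" where
  "uinvertible csc x \<longleftrightarrow> (\<exists>w. umult csc x w = (0, 1) \<and> umult csc w x = (0, 1))"

definition uspectrum :: "(complex \<Rightarrow> 'a::ring \<Rightarrow> 'a) \<Rightarrow> 'a \<Rightarrow> complex set" where
  "uspectrum csc a = {z. \<not> uinvertible csc (a, - z)}"

definition real_rank_zero :: "(complex \<Rightarrow> 'a::{real_normed_algebra,banach} \<Rightarrow> 'a) \<Rightarrow> ('a \<Rightarrow> 'a) \<Rightarrow> bool" where
  "real_rank_zero csc star \<longleftrightarrow>
     (\<forall>x. star x = x \<longrightarrow> (\<forall>\<epsilon>>0. \<exists>y. star y = y \<and> finite (uspectrum csc y) \<and> norm (x - y) < \<epsilon>))"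

text \<open>An element of M_n(A~) is a function nat => nat => A~ vanishing outside {..<n} x {..<n}.\<close>

definition msupp :: "nat \<Rightarrow> (nat \<Rightarrow> nat \<Rightarrow> 'a::zero \<times> complex) \<Rightarrow> bool" where
  "msupp n M \<longleftrightarrow> (\<forall>i j. n \<le> i \<or> n \<le> j \<longrightarrow> M i j = (0, 0))"

definition in_A :: "(nat \<Rightarrow> nat \<Rightarrow> 'a \<times> complex) \<Rightarrow> bool" where
  "in_A M \<longleftrightarrow> (\<forall>i j. snd (M i j) = 0)"

definition mmul :: "(complex \<Rightarrow> 'a::ring \<Rightarrow> 'a) \<Rightarrow> nat \<Rightarrow> (nat \<Rightarrow> nat \<Rightarrow> 'a \<times> complex)
    \<Rightarrow> (nat \<Rightarrow> nat \<Rightarrow> 'a \<times> complex) \<Rightarrow> nat \<Rightarrow> nat \<Rightarrow> 'a \<times> complex" where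
  "mmul csc n M N i j = (\<Sum>k<n. umult csc (M i k) (N k j))"

definition mstar :: "('a \<Rightarrow> 'a) \<Rightarrow> (nat \<Rightarrow> nat \<Rightarrow> 'a \<times> complex) \<Rightarrow> nat \<Rightarrow> nat \<Rightarrow> 'a \<times> complex" where
  "mstar star M i j = ustar star (M j i)"

definition is_uproj :: "(complex \<Rightarrow> 'a::ring \<Rightarrow> 'a) \<Rightarrow> ('a \<Rightarrow> 'a) \<Rightarrow> nat \<Rightarrow> (nat \<Rightarrow> nat \<Rightarrow> 'a \<times> complex) \<Rightarrow> bool" where
  "is_uproj csc star n P \<longleftrightarrow> msupp n P \<and> mstar star P = P \<and> mmul csc n P P = P"

definition is_proj :: "(complex \<Rightarrow> 'a::ring \<Rightarrow> 'a) \<Rightarrow> ('a \<Rightarrow> 'a) \<Rightarrow> nat \<Rightarrow> (nat \<Rightarrow> nat \<Rightarrow> 'a \<times> complex) \<Rightarrow> bool" where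
  "is_proj csc star n P \<longleftrightarrow> is_uproj csc star n P \<and> in_A P"

text \<open>Murray--von Neumann equivalence of P in M_n and Q in M_m, via a partial isometry
  (padded with zeros to a square matrix of size N), over A~ resp. over A.\<close>
definition mvn_u :: "(complex \<Rightarrow> 'a::ring \<Rightarrow> 'a) \<Rightarrow> ('a \<Rightarrow> 'a) \<Rightarrow> nat \<Rightarrow> (nat \<Rightarrow> nat \<Rightarrow> 'a \<times> complex)
    \<Rightarrow> nat \<Rightarrow> (nat \<Rightarrow> nat \<Rightarrow> 'a \<times> complex) \<Rightarrow> bool" where
  "mvn_u csc star n P m Q \<longleftrightarrow> (\<exists>N V. n \<le> N \<and> m \<le> N \<and> msupp N V \<and>
      mmul csc N (mstar star V) V = P \<and> mmul csc N V (mstar star V) = Q)"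

definition mvn_A :: "(complex \<Rightarrow> 'a::ring \<Rightarrow> 'a) \<Rightarrow> ('a \<Rightarrow> 'a) \<Rightarrow> nat \<Rightarrow> (nat \<Rightarrow> nat \<Rightarrow> 'a \<times> complex)
    \<Rightarrow> nat \<Rightarrow> (nat \<Rightarrow> nat \<Rightarrow> 'a \<times> complex) \<Rightarrow> bool" where
  "mvn_A csc star n P m Q \<longleftrightarrow> (\<exists>N V. n \<le> N \<and> m \<le> N \<and> msupp N V \<and> in_A V \<and>
      mmul csc N (mstar star V) V = P \<and> mmul csc N V (mstar star V) = Q)"

definition dsum :: "nat \<Rightarrow> (nat \<Rightarrow> nat \<Rightarrow> 'a::zero \<times> complex) \<Rightarrow> nat \<Rightarrow> (nat \<Rightarrow> nat \<Rightarrow> 'a \<times> complex)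
    \<Rightarrow> nat \<Rightarrow> nat \<Rightarrow> 'a \<times> complex" where
  "dsum n P m Q i j =
     (if i < n \<and> j < n then P i j
      else if n \<le> i \<and> n \<le> j then Q (i - n) (j - n) else (0, 0))"

definition uunit :: "nat \<Rightarrow> nat \<Rightarrow> nat \<Rightarrow> 'a::zero \<times> complex" where
  "uunit k i j = (if i = j \<and> i < k then (0, 1) else (0, 0))"

text \<open>[P]_0 = [Q]_0 in K_0(A) (= ker(K_0(A~) -> K_0(C)), so equality in K_0(A~)):
  P (+) 1_k ~ Q (+) 1_k in M_\<infinity>(A~) for some k.\<close>
definition k0_eq :: "(complex \<Rightarrow> 'a::ring \<Rightarrow> 'a) \<Rightarrow> ('a \<Rightarrow> 'a) \<Rightarrow> nat \<Rightarrow> (nat \<Rightarrow> nat \<Rightarrow> 'a \<times> complex)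
    \<Rightarrow> nat \<Rightarrow> (nat \<Rightarrow> nat \<Rightarrow> 'a \<times> complex) \<Rightarrow> bool" where
  "k0_eq csc star n P m Q \<longleftrightarrow>
     (\<exists>k. mvn_u csc star (n + k) (dsum n P k (uunit k)) (m + k) (dsum m Q k (uunit k)))"

text \<open>[P]_0 \<le> [R]_0, i.e. [R]_0 - [P]_0 \<in> K_0(A)^+ = {[Q]_0 | Q \<in> P_\<infinity>(A)}.\<close>
definition k0_le :: "(complex \<Rightarrow> 'a::ring \<Rightarrow> 'a) \<Rightarrow> ('a \<Rightarrow> 'a) \<Rightarrow> nat \<Rightarrow> (nat \<Rightarrow> nat \<Rightarrow> 'a \<times> complex)
    \<Rightarrow> nat \<Rightarrow> (nat \<Rightarrow> nat \<Rightarrow> 'a \<times> complex) \<Rightarrow> bool" where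
  "k0_le csc star n P m R \<longleftrightarrow>
     (\<exists>l Q. is_proj csc star l Q \<and> k0_eq csc star (n + l) (dsum n P l Q) m R)"

definition has_cancellation :: "(complex \<Rightarrow> 'a::ring \<Rightarrow> 'a) \<Rightarrow> ('a \<Rightarrow> 'a) \<Rightarrow> bool" where
  "has_cancellation csc star \<longleftrightarrow>
     (\<forall>n P m Q. is_proj csc star n P \<longrightarrow> is_proj csc star m Q \<longrightarrow>
        (k0_eq csc star n P m Q \<longleftrightarrow> mvn_A csc star n P m Q))"

definition proj :: "('a \<Rightarrow> 'a) \<Rightarrow> 'a::ring \<Rightarrow> bool" where
  "proj star p \<longleftrightarrow> star p = p \<and> p * p = p"

definition mat1 :: "'a::zero \<Rightarrow> nat \<Rightarrow> nat \<Rightarrow> 'a \<times> complex" where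
  "mat1 p i j = (if i = 0 \<and> j = 0 then (p, 0) else (0, 0))"

definition k0pos_eq_D0 :: "(complex \<Rightarrow> 'a::ring \<Rightarrow> 'a) \<Rightarrow> ('a \<Rightarrow> 'a) \<Rightarrow> bool" where
  "k0pos_eq_D0 csc star \<longleftrightarrow>
     (\<forall>m R. is_proj csc star m R \<longrightarrow> (\<exists>p. proj star p \<and> k0_eq csc star m R 1 (mat1 p)))"

text \<open>Singular value function: s_g(a) for g = [R]_0, R \<in> M_m(A) a projection.\<close>
definition sval :: "(complex \<Rightarrow> 'a::{real_normed_algebra} \<Rightarrow> 'a) \<Rightarrow> ('a \<Rightarrow> 'a) \<Rightarrow> nat \<Rightarrow> (nat \<Rightarrow> nat \<Rightarrow> 'a \<times> complex)
    \<Rightarrow> 'a \<Rightarrow> real" where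
  "sval csc star m R a = Inf {norm (a - a * p) | p. proj star p \<and> k0_le csc star 1 (mat1 p) m R}"

end

theory Submission
  imports
    Defs
    "HOL-Computational_Algebra.Fundamental_Theorem_Algebra"
    "HOL-Library.Function_Algebras"
begin

text \<open>
  Let \<open>p\<close>, \<open>q\<close> be projections competing in \<open>s\<^sub>g(a)\<close>, \<open>s\<^sub>h(b)\<close> and put \<open>c = p b (1 - q)\<close>. Then
  \<open>a b = a (1 - p) b (1 - q) + a c + a b q\<close>, so it suffices to find a projection \<open>r\<close> with
  \<open>[r] \<le> g + h\<close> for which \<open>c (1 - r)\<close> and \<open>q (1 - r)\<close> are small. By real rank zero the element
  \<open>z = c\<^sup>* c + q\<close> is close to some \<open>\<Sum> l e\<^sub>l\<close> with real \<open>l\<close> and orthogonal projections \<open>e\<^sub>l\<close>; take for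
  \<open>r\<close> the sum of the \<open>e\<^sub>l\<close> with \<open>l\<close> not too small. Since \<open>z\<close> is positive, no \<open>l\<close> is very
  negative, which makes \<open>z (1 - r)\<close> small, and \<open>c\<^sup>* c\<close> and \<open>q\<close> are orthogonal. Moreover \<open>r z r\<close> is
  invertible in \<open>r A r\<close>, so \<open>r = t\<^sup>* z t\<close> for some \<open>t\<close>: the column \<open>(c t, q t)\<close> is a partial isometry
  from \<open>r\<close> into \<open>p \<oplus> q\<close>. Cancellation turns the inequalities in \<open>K\<^sub>0\<close> into Murray--von Neumann
  subequivalences over \<open>A\<close>, and back.
\<close>

section \<open>Projections and their orthogonal combinations\<close>

locale cstar =
  fixes csc :: "complex \<Rightarrow> 'a::{real_normed_algebra,banach} \<Rightarrow> 'a"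
    and star :: "'a \<Rightarrow> 'a"
  assumes cstar_algebra: "cstar_algebra csc star"
begin

lemma csc_of_real: "csc (complex_of_real r) x = r *\<^sub>R x"
  and csc_mult_left: "csc c x * y = csc c (x * y)"
  and csc_mult_right: "x * csc c y = csc c (x * y)"
  and norm_csc: "norm (csc c x) = cmod c * norm x"
  and star_star: "star (star x) = x"
  and star_csc: "star (csc c x) = csc (cnj c) (star x)"
  and star_mult: "star (x * y) = star y * star x"
  and norm_star_mult_self: "norm (star x * x) = (norm x)\<^sup>2"
  using cstar_algebra unfolding cstar_algebra_def by metis+

sublocale csc: vector_space csc
  using cstar_algebra unfolding cstar_algebra_def by unfold_locales metis+

lemma bounded_linear_csc_left: "bounded_linear (\<lambda>c. csc c x)"
  by (rule bounded_linear_intro[where K = "norm x"])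
    (simp_all add: csc.scale_left_distrib scaleR_conv_of_real norm_csc flip: csc_of_real)

lemma norm_star: "norm (star x) = norm x"
proof -
  have norm_le: "norm y \<le> norm (star y)" for y
  proof (cases "y = 0")
    case False
    have "norm y * norm y \<le> norm (star y) * norm y"
      using norm_mult_ineq[of "star y" y] norm_star_mult_self[of y] by (simp add: power2_eq_square)
    then show ?thesis using False by simp
  qed simp
  from norm_le[of x] norm_le[of "star x"] show ?thesis by (simp add: star_star)
qed

sublocale star: bounded_linear star
proof (rule bounded_linear_intro[where K = 1])
  show "star (x + y) = star x + star y" for x y
    using cstar_algebra unfolding cstar_algebra_def by metis
  show "star (r *\<^sub>R x) = r *\<^sub>R star x" for r x
    using star_csc[of "complex_of_real r" x] by (simp add: csc_of_real)
qed (simp add: norm_star)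

lemma norm_mult_star_self: "norm (x * star x) = (norm x)\<^sup>2"
  using norm_star_mult_self[of "star x"] by (simp add: star_star norm_star)

lemma star_mult_self_eq_0_iff: "star x * x = 0 \<longleftrightarrow> x = 0"
  using norm_star_mult_self[of x] by auto

lemma proj_star: "proj star p \<Longrightarrow> star p = p"
  and proj_idem: "proj star p \<Longrightarrow> p * p = p"
  by (simp_all add: proj_def)

lemma proj_idem_left: "proj star p \<Longrightarrow> p * (p * x) = p * x"
  by (simp add: proj_idem flip: mult.assoc)

lemma norm_proj_le: "proj star p \<Longrightarrow> norm p \<le> 1"
  using norm_star_mult_self[of p]
  by (cases "p = 0") (simp_all add: proj_star proj_idem power2_eq_square)

lemma norm_proj_mult_le: "proj star p \<Longrightarrow> norm (p * x) \<le> norm x"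
  using norm_mult_ineq[of p x] mult_right_mono[OF norm_proj_le norm_ge_zero[of x]] by fastforce

lemma norm_mult_proj_le: "proj star p \<Longrightarrow> norm (x * p) \<le> norm x"
  using norm_mult_ineq[of x p] mult_left_mono[OF norm_proj_le norm_ge_zero[of x]] by fastforce

lemma norm_reflection:
  assumes "proj star e"
  shows "norm (y - 2 *\<^sub>R (e * y)) = norm y"
proof -
  have "star (y - 2 *\<^sub>R (e * y)) * (y - 2 *\<^sub>R (e * y)) = star y * y"
    by (simp add: star.diff star.add star.scaleR star_mult proj_star[OF assms]
        proj_idem_left[OF assms] algebra_simps scaleR_2)
  then have "(norm (y - 2 *\<^sub>R (e * y)))\<^sup>2 = (norm y)\<^sup>2"
    by (metis norm_star_mult_self)
  then show ?thesis by simp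
qed

lemma norm_diff_scaleR_proj_le:
  assumes e: "proj star e" and m: "0 \<le> m" "m \<le> 2"
  shows "norm (y - m *\<^sub>R (e * y)) \<le> norm y"
proof -
  have "y - m *\<^sub>R (e * y) = (1 - m / 2) *\<^sub>R y + (m / 2) *\<^sub>R (y - 2 *\<^sub>R (e * y))"
    by (simp add: algebra_simps)
  also have "norm \<dots> \<le> (1 - m / 2) * norm y + (m / 2) * norm y"
    using m by (intro order_trans[OF norm_triangle_ineq]) (simp add: norm_reflection[OF e])
  also have "\<dots> = norm y" by (simp add: algebra_simps)
  finally show ?thesis .
qed

lemma norm_diff_proj_left: "proj star e \<Longrightarrow> norm (x - e * x) \<le> norm x"
  using norm_diff_scaleR_proj_le[of e 1 x] by simp

lemma norm_diff_proj_right: "proj star e \<Longrightarrow> norm (x - x * e) \<le> norm x"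
  using norm_diff_proj_left[of e "star x"] norm_star[of "x - x * e"]
  by (simp add: star.diff star_mult proj_star norm_star)

definition orth_proj_family :: "'i set \<Rightarrow> ('i \<Rightarrow> 'a) \<Rightarrow> bool" where
  "orth_proj_family F e \<longleftrightarrow> finite F \<and> (\<forall>i\<in>F. proj star (e i)) \<and>
     (\<forall>i\<in>F. \<forall>j\<in>F. i \<noteq> j \<longrightarrow> e i * e j = 0)"

definition orth_sum :: "'i set \<Rightarrow> ('i \<Rightarrow> 'a) \<Rightarrow> ('i \<Rightarrow> real) \<Rightarrow> 'a" where
  "orth_sum F e l = (\<Sum>i\<in>F. l i *\<^sub>R e i)"

lemma orth_proj_family_subset:
  "orth_proj_family F e \<Longrightarrow> G \<subseteq> F \<Longrightarrow> orth_proj_family G e"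
  unfolding orth_proj_family_def by (meson finite_subset subsetD)

lemma star_orth_sum: "orth_proj_family F e \<Longrightarrow> star (orth_sum F e l) = orth_sum F e l"
  by (simp add: orth_sum_def star.sum star.scaleR orth_proj_family_def proj_star)

lemma orth_sum_mult_proj:
  assumes "orth_proj_family F e" "j \<in> F"
  shows "orth_sum F e l * e j = l j *\<^sub>R e j"
proof -
  have "orth_sum F e l * e j = (\<Sum>i\<in>F. if i = j then l j *\<^sub>R e j else 0)"
    unfolding orth_sum_def sum_distrib_right
    using assms by (intro sum.cong refl) (auto simp: orth_proj_family_def proj_idem)
  then show ?thesis using assms by (simp add: orth_proj_family_def)
qed

lemma orth_sum_mult:
  assumes "orth_proj_family F e"
  shows "orth_sum F e l * orth_sum F e m = orth_sum F e (\<lambda>i. l i * m i)"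
proof -
  have "orth_sum F e l * orth_sum F e m = (\<Sum>i\<in>F. m i *\<^sub>R (orth_sum F e l * e i))"
    unfolding orth_sum_def[of F e m] by (simp add: sum_distrib_left)
  also have "\<dots> = (\<Sum>i\<in>F. (l i * m i) *\<^sub>R e i)"
    by (intro sum.cong refl) (simp add: orth_sum_mult_proj[OF assms] mult.commute)
  finally show ?thesis by (simp only: orth_sum_def)
qed

lemma norm_diff_orth_sum_mult_le:
  assumes "orth_proj_family F e" and "\<And>i. i \<in> F \<Longrightarrow> 0 \<le> m i \<and> m i \<le> 2"
  shows "norm (y - orth_sum F e m * y) \<le> norm y"
proof -
  have "finite F" using assms(1) by (simp add: orth_proj_family_def)
  then show ?thesis using assms
  proof (induction F arbitrary: y rule: finite_induct)
    case (insert j F)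
    have fam: "orth_proj_family F e"
      using insert.prems(1) by (rule orth_proj_family_subset) auto
    have e_j: "proj star (e j)" using insert.prems(1) by (simp add: orth_proj_family_def)
    define y' where "y' = y - m j *\<^sub>R (e j * y)"
    have "orth_sum F e m * e j = 0"
      unfolding orth_sum_def sum_distrib_right
      using insert.prems(1) insert.hyps(2) by (intro sum.neutral) (auto simp: orth_proj_family_def)
    then have "orth_sum F e m * y' = orth_sum F e m * y"
      by (simp add: y'_def right_diff_distrib flip: mult.assoc)
    then have "y - orth_sum (insert j F) e m * y = y' - orth_sum F e m * y'"
      using insert.hyps by (simp add: orth_sum_def y'_def algebra_simps)
    also have "norm \<dots> \<le> norm y'" using insert.prems(2) by (intro insert.IH fam) auto
    also have "\<dots> \<le> norm y"
      unfolding y'_def using insert.prems(2) e_j by (intro norm_diff_scaleR_proj_le) auto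
    finally show ?case .
  qed (simp add: orth_sum_def)
qed

lemma norm_orth_sum_le:
  assumes fam: "orth_proj_family F e" and "L \<ge> 0" and l: "\<And>i. i \<in> F \<Longrightarrow> \<bar>l i\<bar> \<le> L"
  shows "norm (orth_sum F e l) \<le> L"
proof (cases "L = 0")
  case True
  then have "orth_sum F e l = 0" using l by (auto simp: orth_sum_def intro!: sum.neutral)
  then show ?thesis using True by simp
next
  case False
  then have "L > 0" using \<open>L \<ge> 0\<close> by simp
  define x where "x = orth_sum F e l"
  define y where "y = star x"
  define y\<^sub>1 where "y\<^sub>1 = y - orth_sum F e (\<lambda>i. 1 - l i / L) * y"
  define y\<^sub>2 where "y\<^sub>2 = y - orth_sum F e (\<lambda>i. 1 + l i / L) * y"
  have "- 1 \<le> l i / L \<and> l i / L \<le> 1" if "i \<in> F" for i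
    using l[OF that] \<open>L > 0\<close> by (auto simp: field_simps)
  then have "norm y\<^sub>1 \<le> norm y" "norm y\<^sub>2 \<le> norm y"
    unfolding y\<^sub>1_def y\<^sub>2_def by (force intro!: norm_diff_orth_sum_mult_le[OF fam])+
  then have "norm (y\<^sub>1 - y\<^sub>2) \<le> 2 * norm y"
    using norm_triangle_ineq4[of y\<^sub>1 y\<^sub>2] by simp
  moreover have "y\<^sub>1 - y\<^sub>2 = (2 / L) *\<^sub>R (x * y)"
    by (simp add: y\<^sub>1_def y\<^sub>2_def x_def orth_sum_def sum_distrib_right scaleR_sum_right
        flip: sum_subtractf left_diff_distrib scaleR_left_diff_distrib)
  ultimately have "norm x * norm x \<le> L * norm x"
    using \<open>L > 0\<close> norm_mult_star_self[of x]
    by (simp add: y_def norm_star power2_eq_square field_simps)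
  then show ?thesis
    using \<open>L > 0\<close> unfolding x_def[symmetric] by (cases "x = 0") auto
qed

end

section \<open>Inverse square roots in corners\<close>

definition corner_power :: "'b::times \<Rightarrow> 'b \<Rightarrow> nat \<Rightarrow> 'b" where
  "corner_power r s n = ((*) s ^^ n) r"

definition corner_fps :: "'b::{real_normed_algebra,banach} \<Rightarrow> 'b \<Rightarrow> real fps \<Rightarrow> 'b" where
  "corner_fps r s f = (\<Sum>n. fps_nth f n *\<^sub>R corner_power r s n)"

locale corner_element =
  fixes r s :: "'b::{real_normed_algebra,banach}"
  assumes unit_idem: "r * r = r" and unit_mult: "r * s = s" and mult_unit: "s * r = s"
begin

lemma corner_power_0: "corner_power r s 0 = r"
  and corner_power_Suc: "corner_power r s (Suc n) = s * corner_power r s n"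
  by (simp_all add: corner_power_def)

lemma unit_mult_corner_power: "r * corner_power r s n = corner_power r s n"
  by (cases n) (simp_all add: corner_power_0 corner_power_Suc unit_idem unit_mult flip: mult.assoc)

lemma corner_power_add: "corner_power r s (m + n) = corner_power r s m * corner_power r s n"
  by (induction m)
    (simp_all add: corner_power_0 corner_power_Suc unit_mult_corner_power mult.assoc)

lemma norm_corner_power_le: "norm (corner_power r s n) \<le> norm s ^ n * norm r"
proof (induction n)
  case (Suc n)
  have "norm (corner_power r s (Suc n)) \<le> norm s * norm (corner_power r s n)"
    unfolding corner_power_Suc by (rule norm_mult_ineq)
  also have "\<dots> \<le> norm s * (norm s ^ n * norm r)" using Suc by (intro mult_left_mono) auto
  finally show ?case by (simp add: mult.assoc)
qed (simp add: corner_power_0)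

lemma summable_norm_corner_fps:
  assumes "ereal (norm s) < fps_conv_radius f"
  shows "summable (\<lambda>n. norm (fps_nth f n *\<^sub>R corner_power r s n))"
proof (rule summable_comparison_test)
  show "summable (\<lambda>n. norm (fps_nth f n * norm s ^ n) * norm r)"
    using assms by (intro summable_mult2 abs_summable_in_conv_radius)
      (simp flip: fps_conv_radius_def)
  show "\<exists>N. \<forall>n\<ge>N. norm (norm (fps_nth f n *\<^sub>R corner_power r s n))
      \<le> norm (fps_nth f n * norm s ^ n) * norm r"
    using norm_corner_power_le by (simp add: abs_mult mult.assoc mult_left_mono)
qed

lemma corner_fps_mult:
  assumes "ereal (norm s) < fps_conv_radius f" "ereal (norm s) < fps_conv_radius g"
  shows "corner_fps r s (f * g) = corner_fps r s f * corner_fps r s g"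
proof -
  have "(fps_nth f i *\<^sub>R corner_power r s i) * (fps_nth g (n - i) *\<^sub>R corner_power r s (n - i))
      = (fps_nth f i * fps_nth g (n - i)) *\<^sub>R corner_power r s n" if "i \<le> n" for i n
    using that by (simp flip: corner_power_add)
  then have "(\<Sum>i\<le>n. (fps_nth f i *\<^sub>R corner_power r s i) *
        (fps_nth g (n - i) *\<^sub>R corner_power r s (n - i)))
      = fps_nth (f * g) n *\<^sub>R corner_power r s n" for n
    by (simp add: fps_mult_nth scaleR_sum_left atMost_atLeast0)
  then show ?thesis
    using Cauchy_product[OF summable_norm_corner_fps[OF assms(1)]
        summable_norm_corner_fps[OF assms(2)]]
    by (simp add: corner_fps_def)
qed

lemma corner_fps_1: "corner_fps r s 1 = r"
  unfolding corner_fps_def by (subst suminf_finite[of "{0}"]) (auto simp: corner_power_0)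

lemma corner_fps_one_plus_X: "corner_fps r s (1 + fps_X) = r + s"
  unfolding corner_fps_def
  by (subst suminf_finite[of "{0, 1}"])
    (auto simp: corner_power_0 corner_power_Suc fps_X_def mult_unit)

end

context cstar
begin

lemma star_corner_fps:
  assumes "corner_element r s" "proj star r" "star s = s" "ereal (norm s) < fps_conv_radius f"
  shows "star (corner_fps r s f) = corner_fps r s f"
proof -
  interpret corner_element r s by (rule assms(1))
  have "star (corner_power r s n) = corner_power r s n" for n
  proof (induction n)
    case (Suc n)
    have "star (corner_power r s (Suc n)) = corner_power r s n * corner_power r s 1"
      by (simp add: Suc corner_power_Suc corner_power_0 mult_unit star_mult assms(3))
    then show ?case by (simp flip: corner_power_add)
  qed (simp add: corner_power_0 proj_star[OF assms(2)])
  then show ?thesis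
    using summable_norm_cancel[OF summable_norm_corner_fps[OF assms(4)]]
    by (simp add: corner_fps_def star.suminf star.scaleR)
qed

lemma corner_inverse_sqrt:
  assumes r: "proj star r" and s: "star s = s" "r * s = s" "norm s < 1"
  shows "\<exists>w. star w = w \<and> w * (r + s) * w = r"
proof -
  have "s * r = s" using arg_cong[OF s(2), of star] by (simp add: star_mult s(1) proj_star[OF r])
  then interpret corner_element r s
    using s(2) proj_idem[OF r] by unfold_locales
  define b where "b = fps_binomial (- 1 / 2 :: real)"
  have "(- 1 / 2 :: real) \<notin> \<nat>"
    by (auto simp: Nats_def)
  then have conv_b: "ereal (norm s) < fps_conv_radius b"
    using s(3) by (simp add: b_def fps_conv_radius_binomial)
  have conv_b_mult: "ereal (norm s) < fps_conv_radius (b * (1 + fps_X))"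
    using conv_b fps_conv_radius_mult[of b "1 + fps_X"] fps_conv_radius_add[of 1 "fps_X :: real fps"]
    by (auto simp: min_def split: if_splits)
  have "b * (1 + fps_X) * b = fps_binomial 0"
    unfolding b_def fps_binomial_1[symmetric] fps_binomial_add_mult[symmetric] by simp
  then have "corner_fps r s b * (r + s) * corner_fps r s b = r"
    using conv_b conv_b_mult fps_conv_radius_add[of 1 "fps_X :: real fps"]
    by (simp add: corner_fps_1 flip: corner_fps_mult corner_fps_one_plus_X)
  moreover have "star (corner_fps r s b) = corner_fps r s b"
    by (rule star_corner_fps[OF corner_element_axioms r s(1) conv_b])
  ultimately show ?thesis by blast
qed

lemma ex_factor_of_near_proj:
  assumes r: "proj star r" and z: "star z = z" and x: "x * r = x"
    and near: "norm (star x * z * x - r) < 1"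
  shows "\<exists>t. star t * z * t = r"
proof -
  define s where "s = star x * z * x - r"
  have "r * star x = star x" using arg_cong[OF x, of star] by (simp add: star_mult proj_star[OF r])
  then have "r * s = s"
    by (simp add: s_def right_diff_distrib proj_idem[OF r] flip: mult.assoc)
  moreover have "star s = s"
    by (simp add: s_def star.diff star_mult star_star z proj_star[OF r] mult.assoc)
  ultimately obtain w where w: "star w = w" "w * (r + s) * w = r"
    using corner_inverse_sqrt[OF r] near unfolding s_def by blast
  have "star (x * w) * z * (x * w) = w * (r + s) * w"
    by (simp add: s_def star_mult w(1) mult.assoc)
  then show ?thesis using w(2) by metis
qed

end

section \<open>Positivity\<close>

text \<open>For self-adjoint \<open>a\<close> this is a first-order form of \<open>a \<ge> 0\<close> that is stable under addition and
  needs no spectral theory.\<close>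

definition accretive :: "'b::real_normed_algebra \<Rightarrow> bool" where
  "accretive a \<longleftrightarrow> (\<exists>C. \<forall>t\<ge>0. \<forall>y. norm (y - t *\<^sub>R (a * y)) \<le> (1 + C * t\<^sup>2) * norm y)"

lemma accretive_add:
  assumes "accretive a" "accretive b"
  shows "accretive (a + b)"
proof -
  obtain A B where A: "\<And>t y. 0 \<le> t \<Longrightarrow> norm (y - t *\<^sub>R (a * y)) \<le> (1 + A * t\<^sup>2) * norm y"
    and B: "\<And>t y. 0 \<le> t \<Longrightarrow> norm (y - t *\<^sub>R (b * y)) \<le> (1 + B * t\<^sup>2) * norm y"
    using assms unfolding accretive_def by blast
  have "norm (y - t *\<^sub>R ((a + b) * y)) \<le> (1 + (2 * A + 2 * B) * t\<^sup>2) * norm y" if "0 \<le> t" for t y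
  proof -
    have "y - t *\<^sub>R ((a + b) * y)
        = (1 / 2) *\<^sub>R ((y - (2 * t) *\<^sub>R (a * y)) + (y - (2 * t) *\<^sub>R (b * y)))"
      by (simp add: algebra_simps flip: scaleR_add_left)
    also have "norm \<dots> \<le> (1 / 2) * ((1 + A * (2 * t)\<^sup>2) * norm y + (1 + B * (2 * t)\<^sup>2) * norm y)"
      unfolding norm_scaleR
      using that by (intro mult_mono order_trans[OF norm_triangle_ineq] add_mono A B) auto
    also have "\<dots> = (1 + (2 * A + 2 * B) * t\<^sup>2) * norm y"
      by (simp add: field_simps power2_eq_square)
    finally show ?thesis .
  qed
  then show ?thesis unfolding accretive_def by blast
qed

lemma accretive_minus_idem_imp_0:
  assumes "accretive (- e)" "e * e = e"
  shows "e = 0"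
proof (rule ccontr)
  assume "e \<noteq> 0"
  obtain C where C: "\<And>t y. 0 \<le> t \<Longrightarrow> norm (y + t *\<^sub>R (e * y)) \<le> (1 + C * t\<^sup>2) * norm y"
    using assms(1) unfolding accretive_def by auto
  define t where "t = 1 / (\<bar>C\<bar> + 1)"
  have t: "t > 0" "C * t < 1" by (auto simp: t_def field_simps)
  have "(1 + t) * norm e = norm (e + t *\<^sub>R (e * e))"
    using t(1) by (simp add: assms(2) flip: scaleR_left_distrib[of 1 t e, simplified])
  also have "\<dots> \<le> (1 + C * t\<^sup>2) * norm e" using C t(1) by simp
  finally have "1 \<le> C * t"
    using t(1) \<open>e \<noteq> 0\<close> by (simp add: power2_eq_square)
  then show False using t(2) by simp
qed

context cstar
begin

text \<open>The two factors \<open>1 \<plusminus> i h\<close> of \<open>1 + h\<^sup>2\<close> differ by a unitary (the Cayley transform of \<open>h\<close>),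
  and their mean is \<open>1\<close>.\<close>

lemma norm_le_norm_add_imaginary:
  assumes h: "star h = h"
  shows "norm y \<le> norm (y + csc \<i> (h * y))"
proof -
  define v where "v = y + csc \<i> (h * y)"
  define v' where "v' = y - csc \<i> (h * y)"
  have "star v * v = star v' * v'"
    by (simp add: v_def v'_def star.add star.diff star_mult star_csc h csc_mult_left csc_mult_right
        algebra_simps)
  then have "(norm v)\<^sup>2 = (norm v')\<^sup>2" by (metis norm_star_mult_self)
  then have "norm v' = norm v" by simp
  moreover have "2 *\<^sub>R y = v + v'" by (simp add: v_def v'_def scaleR_2)
  then have "2 * norm y \<le> norm v + norm v'"
    using norm_triangle_ineq[of v v'] norm_scaleR[of 2 y] by simp
  ultimately show ?thesis by (simp add: v_def)
qed

lemma norm_le_norm_add_square: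
  assumes "star h = h"
  shows "norm y \<le> norm (y + h * h * y)"
proof -
  define x where "x = y + csc \<i> (h * y)"
  have "norm y \<le> norm x"
    unfolding x_def by (rule norm_le_norm_add_imaginary[OF assms])
  also have "\<dots> \<le> norm (x + csc \<i> (- h * x))"
    using assms by (intro norm_le_norm_add_imaginary) (simp add: star.neg)
  also have "x + csc \<i> (- h * x) = y + h * h * y"
    by (simp add: x_def algebra_simps csc_mult_right)
  finally show ?thesis .
qed

lemma accretive_square:
  assumes h: "star h = h"
  shows "accretive (h * h)"
proof -
  have "norm (y - t *\<^sub>R (h * h * y)) \<le> (1 + (norm (h * h))\<^sup>2 * t\<^sup>2) * norm y" if "0 \<le> t" for t y
  proof -
    define g where "g = sqrt t *\<^sub>R h"
    have gg: "g * g = t *\<^sub>R (h * h)" using that by (simp add: g_def)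
    have "norm (y - g * g * y) \<le> norm ((y - g * g * y) + g * g * (y - g * g * y))"
      by (rule norm_le_norm_add_square) (simp add: g_def star.scaleR h)
    also have "(y - g * g * y) + g * g * (y - g * g * y) = y - t\<^sup>2 *\<^sub>R (h * h * (h * h * y))"
      by (simp add: gg right_diff_distrib power2_eq_square)
    also have "norm \<dots> \<le> norm y + t\<^sup>2 * norm (h * h * (h * h * y))"
      by (rule order_trans[OF norm_triangle_ineq4]) simp
    also have "norm (h * h * (h * h * y)) \<le> norm (h * h) * (norm (h * h) * norm y)"
      by (rule order_trans[OF norm_mult_ineq mult_left_mono[OF norm_mult_ineq norm_ge_zero]])
    then have "norm y + t\<^sup>2 * norm (h * h * (h * h * y))
        \<le> norm y + t\<^sup>2 * (norm (h * h) * (norm (h * h) * norm y))"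
      by (intro add_left_mono mult_left_mono) simp_all
    finally show ?thesis by (simp add: gg algebra_simps power2_eq_square)
  qed
  then show ?thesis unfolding accretive_def by blast
qed

text \<open>Kaplansky's argument: with \<open>h\<close>, \<open>k\<close> twice the real and imaginary parts of \<open>u\<close>, the projection
  \<open>f = - u u\<^sup>*\<close> exhibits \<open>- e\<close> as the sum of squares \<open>h\<^sup>2 + k\<^sup>2 + f\<^sup>2 + f\<^sup>2 + e\<^sup>2\<close>.\<close>

lemma star_mult_self_eq_minus_proj_imp_0:
  assumes e: "proj star e" and v: "star v * v = - e"
  shows "e = 0"
proof -
  define u where "u = v * e"
  have u: "star u * u = - e"
    by (simp add: u_def star_mult proj_star[OF e] mult.assoc)
      (simp add: v proj_idem[OF e] flip: mult.assoc[of "star v"])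
  define f where "f = - (u * star u)"
  have "f * f = u * (star u * u) * star u" by (simp add: f_def mult.assoc)
  then have f: "proj star f"
    by (simp add: u proj_def f_def star.neg star_mult star_star)
      (simp add: u_def mult.assoc proj_idem_left[OF e])
  define h where "h = u + star u"
  define k where "k = csc \<i> (u - star u)"
  have "star h = h" by (simp add: h_def star.add star_star add.commute)
  moreover have "star k = k"
    by (simp add: k_def star_csc star.diff star_star csc.scale_right_diff_distrib)
  ultimately have "accretive (h * h + k * k + f * f + f * f + e * e)"
    using f e by (intro accretive_add accretive_square) (simp_all add: proj_star)
  moreover have "k * k = - ((u - star u) * (u - star u))"
    by (simp add: k_def csc_mult_left csc_mult_right)
  then have "h * h + k * k + f * f + f * f + e * e = - e"
    by (simp add: h_def algebra_simps proj_idem[OF e] proj_idem[OF f]) (simp add: f_def u)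
  ultimately show ?thesis
    using accretive_minus_idem_imp_0 proj_idem[OF e] by metis
qed

lemma norm_corner_star_mult_self_diff_ge:
  assumes e: "proj star e" "e \<noteq> 0"
  shows "- l \<le> norm (e * (star c * c) * e - l *\<^sub>R e)"
proof (rule ccontr)
  assume "\<not> - l \<le> norm (e * (star c * c) * e - l *\<^sub>R e)"
  then have near: "norm (e * (star c * c) * e - l *\<^sub>R e) < - l" by simp
  then have "l < 0" using norm_ge_zero le_less_trans neg_0_less_iff_less by blast
  define x where "x = (1 / sqrt (- l)) *\<^sub>R e"
  have near_eq: "star x * - (star c * c) * x - e = (1 / l) *\<^sub>R (e * (star c * c) * e - l *\<^sub>R e)"
    using \<open>l < 0\<close>
    by (simp add: x_def star.scaleR proj_star[OF e(1)] scaleR_diff_right mult.assoc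
        real_sqrt_mult_self)
  have "norm (star x * - (star c * c) * x - e) < 1"
    unfolding near_eq norm_scaleR using near \<open>l < 0\<close>
    by (simp only: abs_divide) (simp add: divide_simps)
  moreover have "star (- (star c * c)) = - (star c * c)" by (simp add: star.neg star_mult star_star)
  moreover have "x * e = x" by (simp add: x_def proj_idem[OF e(1)])
  ultimately obtain t where "star t * - (star c * c) * t = e"
    using ex_factor_of_near_proj[OF e(1)] by blast
  then have "star (c * t) * (c * t) = - e"
    by (simp add: star_mult mult.assoc minus_equation_iff)
  then show False using star_mult_self_eq_minus_proj_imp_0[OF e(1)] e(2) by blast
qed

end

section \<open>Quasi-inverses\<close>

text \<open>In a unital ring this says that \<open>1 + w\<close> is the inverse of \<open>1 - x\<close>.\<close>

definition quasi_inverse :: "'b::ring \<Rightarrow> 'b \<Rightarrow> bool" where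
  "quasi_inverse x w \<longleftrightarrow> w = x + x * w \<and> w = x + w * x"

lemma quasi_inverse_square:
  fixes x :: "'b::real_algebra"
  assumes a: "quasi_inverse x a" and b: "quasi_inverse (- x) b"
  shows "quasi_inverse (x * x) ((1 / 2) *\<^sub>R (a + b))"
proof -
  have twice: "w = y + y * y + y * y * w" "w = y + y * y + w * (y * y)"
    if "quasi_inverse y w" for y w :: 'b
  proof -
    have left: "y + y * w = w" and right: "y + w * y = w"
      using that by (auto simp: quasi_inverse_def)
    have "y + y * y + y * y * w = y + y * (y + y * w)" by (simp add: algebra_simps)
    then show "w = y + y * y + y * y * w" by (simp add: left)
    have "y + y * y + w * (y * y) = y + (y + w * y) * y" by (simp add: algebra_simps)
    then show "w = y + y * y + w * (y * y)" by (simp add: right)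
  qed
  have left: "a + b = 2 *\<^sub>R (x * x) + x * x * (a + b)"
    by (subst twice(1)[OF a], subst twice(1)[OF b]) (simp add: algebra_simps scaleR_2)
  have right: "a + b = 2 *\<^sub>R (x * x) + (a + b) * (x * x)"
    by (subst twice(2)[OF a], subst twice(2)[OF b]) (simp add: algebra_simps scaleR_2)
  have "(1 / 2) *\<^sub>R (2 *\<^sub>R (x * x) + u) = x * x + (1 / 2) *\<^sub>R u" for u
    by (simp add: scaleR_add_right)
  then show ?thesis
    unfolding quasi_inverse_def using left right by (metis mult_scaleR_left mult_scaleR_right)
qed

lemma norm_quasi_inverse_diff_le:
  fixes x y :: "'b::real_normed_algebra"
  assumes "quasi_inverse x a" "quasi_inverse y b"
  shows "norm (a - b) \<le> norm (x - y) * (1 + norm a) * (1 + norm b)"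
proof -
  have a: "x + a * x = a" and b: "y + y * b = b"
    using assms by (auto simp: quasi_inverse_def)
  define d where "d = (x - y) + a * (x - y)"
  have "d + d * b = (x + a * x) + (x + a * x) * b - (y + y * b) - a * (y + y * b)"
    by (simp add: d_def algebra_simps)
  then have "a - b = d + d * b" by (simp add: a b)
  also have "norm \<dots> \<le> norm d + norm d * norm b"
    by (rule order_trans[OF norm_triangle_ineq add_left_mono[OF norm_mult_ineq]])
  also have "\<dots> = norm d * (1 + norm b)" by (simp add: algebra_simps)
  also have "norm d \<le> norm (x - y) + norm a * norm (x - y)"
    unfolding d_def by (rule order_trans[OF norm_triangle_ineq add_left_mono[OF norm_mult_ineq]])
  then have "norm d * (1 + norm b) \<le> norm (x - y) * (1 + norm a) * (1 + norm b)"
    by (intro mult_right_mono) (simp_all add: algebra_simps)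
  finally show ?thesis .
qed

lemma continuous_on_quasi_inverse:
  fixes X :: "'c::topological_space \<Rightarrow> 'b::real_normed_algebra"
  assumes X: "continuous_on S X" and W: "\<And>z. z \<in> S \<Longrightarrow> quasi_inverse (X z) (W z)"
  shows "continuous_on S W"
  unfolding continuous_on_def
proof
  fix z assume "z \<in> S"
  define M where "M = 1 + norm (W z)"
  define d where "d y = norm (X y - X z)" for y
  have "M > 0" by (simp add: M_def add_pos_nonneg)
  have "(X \<longlongrightarrow> X z) (at z within S)" using X \<open>z \<in> S\<close> by (simp add: continuous_on_def)
  then have d: "(d \<longlongrightarrow> 0) (at z within S)"
    unfolding d_def by (intro tendsto_norm_zero LIM_zero)
  have bound: "norm (W y - W z) \<le> 2 * M\<^sup>2 * d y" if "y \<in> S" "d y < 1 / (2 * M)" for y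
  proof -
    define n where "n = norm (W y - W z)"
    have "d y * M \<le> 1 / 2" using that(2) \<open>M > 0\<close> by (simp add: field_simps)
    have "norm (W y) \<le> norm (W z) + n" unfolding n_def by (rule norm_triangle_sub)
    then have "n \<le> d y * (M + n) * M"
      using norm_quasi_inverse_diff_le[OF W[OF that(1)] W[OF \<open>z \<in> S\<close>]] \<open>M > 0\<close>
      unfolding n_def d_def M_def
      by (elim order_trans) (intro mult_right_mono mult_left_mono; simp)
    also have "\<dots> = M\<^sup>2 * d y + d y * M * n" by (simp add: algebra_simps power2_eq_square)
    also have "\<dots> \<le> M\<^sup>2 * d y + 1 / 2 * n"
      using \<open>d y * M \<le> 1 / 2\<close> by (intro add_left_mono mult_right_mono) (auto simp: n_def)
    finally show ?thesis by (simp add: n_def)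
  qed
  have "\<forall>\<^sub>F y in at z within S. y \<in> S \<and> d y < 1 / (2 * M)"
    using order_tendstoD(2)[OF d, of "1 / (2 * M)"] \<open>M > 0\<close>
    by (auto simp: eventually_at_filter elim: eventually_mono)
  then have "\<forall>\<^sub>F y in at z within S. norm (W y - W z) \<le> 2 * M\<^sup>2 * d y"
    by (rule eventually_mono) (use bound in blast)
  moreover have "((\<lambda>y. 2 * M\<^sup>2 * d y) \<longlongrightarrow> 0) (at z within S)"
    by (rule tendsto_mult_right_zero[OF d])
  ultimately have "((\<lambda>y. W y - W z) \<longlongrightarrow> 0) (at z within S)"
    by (rule Lim_null_comparison)
  then show "(W \<longlongrightarrow> W z) (at z within S)" by (rule LIM_zero_cancel)
qed

context cstar
begin

definition resolvents_close :: "real \<Rightarrow> real \<Rightarrow> 'a \<Rightarrow> bool" where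
  "resolvents_close \<delta> s k \<longleftrightarrow> (\<forall>z. cmod z = 1 \<longrightarrow> (\<exists>a b. quasi_inverse (csc z k) a \<and>
     quasi_inverse (csc (complex_of_real s * z) k) b \<and> norm (a - b) \<le> \<delta>))"

lemma ex_resolvents_close:
  assumes "\<And>z. \<exists>w. quasi_inverse (csc z k) w" and "\<delta> > 0"
  shows "\<exists>s. 0 \<le> s \<and> s < 1 \<and> resolvents_close \<delta> s k"
proof -
  obtain W where W: "\<And>z. quasi_inverse (csc z k) (W z)" using assms(1) by metis
  have "continuous_on (cball 0 1) W"
    by (rule continuous_on_quasi_inverse[OF _ W])
      (rule bounded_linear.continuous_on[OF bounded_linear_csc_left continuous_on_id])
  then have "uniformly_continuous_on (cball 0 1) W"
    by (rule compact_uniformly_continuous) simp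
  then obtain d where d: "d > 0"
    "\<And>y z. y \<in> cball 0 1 \<Longrightarrow> z \<in> cball 0 1 \<Longrightarrow> dist y z < d \<Longrightarrow> dist (W y) (W z) < \<delta>"
    using \<open>\<delta> > 0\<close> unfolding uniformly_continuous_on_def by metis
  define s where "s = 1 - min 1 d / 2"
  have s: "0 \<le> s" "s < 1" "1 - s < d" using d(1) by (auto simp: s_def)
  have "norm (W z - W (s * z)) \<le> \<delta>" if "cmod z = 1" for z :: complex
  proof -
    have "z - s * z = complex_of_real (1 - s) * z" by (simp add: algebra_simps)
    then have "dist z (s * z) < d" using s that by (simp add: dist_norm norm_mult del: of_real_diff)
    then show ?thesis
      using d(2)[of z "s * z"] that s by (simp add: dist_norm norm_mult less_imp_le)
  qed
  then have "resolvents_close \<delta> s k"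
    unfolding resolvents_close_def using W by blast
  then show ?thesis using s by blast
qed

text \<open>Passing from \<open>k\<close> to \<open>k * k\<close> averages the quasi-inverses of \<open>z k\<close> and \<open>- z k\<close>, so their
  variation between the radii \<open>s\<close> and \<open>1\<close> does not grow while \<open>s\<close> is squared. After
  enough squarings the inner quasi-inverse is nearly \<open>0\<close>, which forces \<open>k\<close> to have norm below \<open>1\<close>.\<close>

lemma resolvents_close_square:
  assumes "resolvents_close \<delta> s k"
  shows "resolvents_close \<delta> (s\<^sup>2) (k * k)"
  unfolding resolvents_close_def
proof (intro allI impI)
  fix z :: complex assume "cmod z = 1"
  define x where "x = csqrt z"
  have z: "z = x * x" by (simp add: x_def flip: power2_eq_square)
  have square: "csc (y * y) (k * k) = csc y k * csc y k" for y
    by (simp add: csc_mult_left csc_mult_right)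
  have x: "cmod x = 1" "cmod (- x) = 1" using \<open>cmod z = 1\<close> by (simp_all add: x_def)
  obtain a b where ab: "quasi_inverse (csc x k) a" "quasi_inverse (csc (s * x) k) b"
    "norm (a - b) \<le> \<delta>"
    using assms x(1) unfolding resolvents_close_def by blast
  obtain a' b' where ab': "quasi_inverse (- csc x k) a'" "quasi_inverse (- csc (s * x) k) b'"
    "norm (a' - b') \<le> \<delta>"
    using assms x(2) unfolding resolvents_close_def by fastforce
  have "quasi_inverse (csc z (k * k)) ((1 / 2) *\<^sub>R (a + a'))"
    unfolding z square by (rule quasi_inverse_square) fact+
  moreover have "quasi_inverse (csc (s * x * (s * x)) (k * k)) ((1 / 2) *\<^sub>R (b + b'))"
    unfolding square by (rule quasi_inverse_square) fact+
  moreover have "complex_of_real (s\<^sup>2) * z = s * x * (s * x)"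
    by (simp add: z power2_eq_square)
  moreover have "norm ((1 / 2) *\<^sub>R (a + a') - (1 / 2) *\<^sub>R (b + b')) \<le> \<delta>"
  proof -
    have "(1 / 2) *\<^sub>R (a + a') - (1 / 2) *\<^sub>R (b + b') = (1 / 2) *\<^sub>R ((a - b) + (a' - b'))"
      by (simp add: algebra_simps)
    then show ?thesis
      using ab(3) ab'(3) norm_triangle_ineq[of "a - b" "a' - b'"] by simp
  qed
  ultimately show "\<exists>a b. quasi_inverse (csc z (k * k)) a \<and>
      quasi_inverse (csc (complex_of_real (s\<^sup>2) * z) (k * k)) b \<and> norm (a - b) \<le> \<delta>"
    by metis
qed

lemma resolvents_close_iterated_square:
  assumes "resolvents_close \<delta> s k"
  shows "resolvents_close \<delta> (s ^ (2 ^ m)) (((\<lambda>x. x * x) ^^ m) k)"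
proof (induction m)
  case (Suc m)
  have "s ^ (2 ^ Suc m) = (s ^ (2 ^ m))\<^sup>2" by (simp add: mult.commute flip: power_mult)
  then show ?case using resolvents_close_square[OF Suc] by simp
qed (simp add: assms)

lemma norm_iterated_square:
  assumes "star k = k"
  shows "norm (((\<lambda>x. x * x) ^^ m) k) = norm k ^ (2 ^ m)"
proof -
  have "star (((\<lambda>x. x * x) ^^ m) k) = ((\<lambda>x. x * x) ^^ m) k
      \<and> norm (((\<lambda>x. x * x) ^^ m) k) = norm k ^ (2 ^ m)"
  proof (induction m)
    case (Suc m)
    have "norm k ^ (2 ^ Suc m) = (norm k ^ (2 ^ m))\<^sup>2" by (simp add: mult.commute flip: power_mult)
    then show ?case
      using Suc norm_star_mult_self[of "((\<lambda>x. x * x) ^^ m) k"] by (simp add: star_mult)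
  qed (simp add: assms)
  then show ?thesis ..
qed

lemma norm_less_1_of_resolvents_close:
  assumes "resolvents_close (1 / 4) s k" and s: "0 \<le> s" "s \<le> 1 / 10" and k: "norm k \<le> 1"
  shows "norm k < 1"
proof -
  obtain a b where a: "quasi_inverse (csc 1 k) a"
    and b: "quasi_inverse (csc (complex_of_real s) k) b"
    and ab: "norm (a - b) \<le> 1 / 4"
    using assms(1) unfolding resolvents_close_def by (metis mult.right_neutral norm_one)
  have "b = s *\<^sub>R (k + k * b)"
    using b by (simp add: quasi_inverse_def csc_of_real scaleR_add_right)
  then have "norm b = s * norm (k + k * b)" using s(1) norm_scaleR[of s "k + k * b"] by simp
  also have "\<dots> \<le> 1 / 10 * (1 + norm b)"
    using s k norm_mult_ineq[of k b] mult_right_mono[OF k norm_ge_zero[of b]]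
    by (intro mult_mono order_trans[OF norm_triangle_ineq]) auto
  finally have "norm b \<le> 1 / 9" by simp
  then have "norm a \<le> 1 / 9 + 1 / 4" using ab norm_triangle_sub[of a b] by simp
  moreover have "k = a - k * a" using a by (simp add: quasi_inverse_def algebra_simps)
  then have "norm k \<le> norm a + norm (k * a)" by (metis norm_triangle_ineq4)
  moreover have "norm (k * a) \<le> norm a"
    using norm_mult_ineq[of k a] mult_right_mono[OF k norm_ge_zero[of a]] by simp
  ultimately show ?thesis by simp
qed

lemma selfadjoint_quasinilpotent_eq_0:
  assumes k: "star k = k" and inv: "\<And>z. \<exists>w. quasi_inverse (csc z k) w"
  shows "k = 0"
proof (rule ccontr)
  assume "k \<noteq> 0"
  define h where "h = (1 / norm k) *\<^sub>R k"
  have h: "star h = h" "norm h = 1" using k \<open>k \<noteq> 0\<close> by (simp_all add: h_def star.scaleR)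
  have "csc z h = csc (z / norm k) k" for z
    by (simp add: h_def flip: csc_of_real)
  then have "\<exists>w. quasi_inverse (csc z h) w" for z using inv by metis
  then obtain s where s: "0 \<le> s" "s < 1" "resolvents_close (1 / 4) s h"
    using ex_resolvents_close[of h "1 / 4"] by auto
  obtain N where N: "s ^ N < 1 / 10"
    using real_arch_pow_inv[of "1 / 10" s] s(2) by auto
  have "s ^ (2 ^ N) \<le> s ^ N"
    using s by (intro power_decreasing) (auto intro: less_imp_le[OF less_exp])
  then have "norm (((\<lambda>x. x * x) ^^ N) h) < 1"
    using s N h
    by (intro norm_less_1_of_resolvents_close[OF resolvents_close_iterated_square[OF s(3)]])
      (simp_all add: norm_iterated_square)
  then show False using h by (simp add: norm_iterated_square)
qed

end

section \<open>Elements with finite spectrum\<close>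

definition lagrange_poly :: "'b::field set \<Rightarrow> 'b \<Rightarrow> 'b poly" where
  "lagrange_poly S \<nu> = (\<Prod>\<mu>\<in>S - {\<nu>}. smult (1 / (\<nu> - \<mu>)) [:- \<mu>, 1:])"

lemma poly_lagrange_poly:
  assumes "finite S" "\<mu> \<in> S"
  shows "poly (lagrange_poly S \<nu>) \<mu> = (if \<mu> = \<nu> then 1 else 0)"
proof (cases "\<mu> = \<nu>")
  case True
  then show ?thesis
    by (auto simp: lagrange_poly_def poly_prod simp flip: diff_divide_distrib
        split: if_splits intro!: prod.neutral)
next
  case False
  then show ?thesis using assms by (auto simp: lagrange_poly_def poly_prod intro!: prod_zero)
qed

context cstar
begin

lemma umult_pair: "umult csc (a, c) (b, d) = (a * b + csc c b + csc d a, c * d)"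
  by (simp add: umult_def)

lemma umult_assoc: "umult csc (umult csc x y) z = umult csc x (umult csc y z)"
  by (cases x; cases y; cases z)
    (simp add: umult_pair algebra_simps csc_mult_left csc_mult_right)

sublocale umult_left: Modules.additive "\<lambda>x. umult csc x y" for y
proof
  show "umult csc (x + x') y = umult csc x y + umult csc x' y" for x x'
    by (cases x; cases x'; cases y) (simp add: umult_pair algebra_simps)
qed

sublocale umult_right: Modules.additive "umult csc x" for x
proof
  show "umult csc x (y + y') = umult csc x y + umult csc x y'" for y y'
    by (cases x; cases y; cases y') (simp add: umult_pair algebra_simps)
qed

lemma umult_one_left: "umult csc (0, 1) x = x"
  by (cases x) (simp add: umult_pair)

lemma ustar_umult: "ustar star (umult csc x y) = umult csc (ustar star y) (ustar star x)"
  by (cases x; cases y) (simp add: umult_pair ustar_def star.add star_mult star_csc)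

lemma ustar_ustar: "ustar star (ustar star x) = x"
  by (simp add: ustar_def star_star)

sublocale ustar: Modules.additive "ustar star"
  by standard (simp add: ustar_def star.add)

declare umult_left.zero [simp] umult_right.zero [simp] ustar.zero [simp]

lemma uinvertible_umult:
  assumes "uinvertible csc x" "uinvertible csc y"
  shows "uinvertible csc (umult csc x y)"
proof -
  obtain v w where v: "umult csc x v = (0, 1)" "umult csc v x = (0, 1)"
    and w: "umult csc y w = (0, 1)" "umult csc w y = (0, 1)"
    using assms unfolding uinvertible_def by blast
  have "umult csc (umult csc x y) (umult csc w v) = umult csc x (umult csc (umult csc y w) v)"
    by (simp only: umult_assoc)
  moreover have "umult csc (umult csc w v) (umult csc x y)
      = umult csc w (umult csc (umult csc v x) y)"
    by (simp only: umult_assoc)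
  ultimately show ?thesis
    unfolding uinvertible_def using v w by (metis umult_one_left)
qed

lemma uinvertible_ustar:
  assumes "uinvertible csc x"
  shows "uinvertible csc (ustar star x)"
proof -
  obtain w where "umult csc x w = (0, 1)" "umult csc w x = (0, 1)"
    using assms unfolding uinvertible_def by blast
  moreover have "ustar star (0, 1) = (0, 1)" by (simp add: ustar_def star.zero)
  ultimately show ?thesis unfolding uinvertible_def by (metis ustar_umult)
qed

lemma uinvertible_imp_quasi_inverse:
  assumes "uinvertible csc (- x, 1)"
  shows "\<exists>w. quasi_inverse x w"
proof -
  obtain w d where w: "umult csc (- x, 1) (w, d) = (0, 1)" "umult csc (w, d) (- x, 1) = (0, 1)"
    using assms unfolding uinvertible_def by auto
  then have "d = 1" by (simp add: umult_pair)
  then have "w = x + x * w" "w = x + w * x"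
    using w by (auto simp: umult_pair algebra_simps)
  then show ?thesis unfolding quasi_inverse_def by blast
qed

lemma zero_in_uspectrum: "0 \<in> uspectrum csc y"
  by (auto simp: uspectrum_def uinvertible_def umult_def)

lemma cnj_in_uspectrum:
  assumes "star y = y" "\<mu> \<in> uspectrum csc y"
  shows "cnj \<mu> \<in> uspectrum csc y"
proof -
  have "ustar star (y, - cnj \<mu>) = (y, - \<mu>)" by (simp add: ustar_def assms)
  then show ?thesis using assms(2) uinvertible_ustar[of "(y, - cnj \<mu>)"] by (auto simp: uspectrum_def)
qed

definition upoly :: "'a \<Rightarrow> complex poly \<Rightarrow> 'a \<times> complex" where
  "upoly y f = fold_coeffs (\<lambda>c x. (0, c) + umult csc (y, 0) x) f 0"

lemma upoly_0 [simp]: "upoly y 0 = 0"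
  by (simp add: upoly_def)

lemma upoly_pCons: "upoly y (pCons c f) = (0, c) + umult csc (y, 0) (upoly y f)"
  by (cases "c = 0 \<and> f = 0") (auto simp: upoly_def simp flip: zero_prod_def)

lemma upoly_const: "upoly y [:c:] = (0, c)"
  by (simp add: upoly_pCons)

lemma upoly_linear: "upoly y [:c, d:] = (csc d y, c)"
  by (simp add: upoly_pCons umult_pair)

lemma snd_upoly: "snd (upoly y f) = poly f 0"
  by (cases f) (simp add: upoly_pCons umult_def)

lemma upoly_add: "upoly y (f + g) = upoly y f + upoly y g"
proof (induction f g rule: poly_induct2)
  case (pCons a p b q)
  have "(0::'a, a + b) = (0, a) + (0, b)" by simp
  then show ?case unfolding add_pCons upoly_pCons pCons umult_right.add by (simp only: ac_simps)
qed simp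

lemma upoly_sum: "upoly y (sum f F) = (\<Sum>i\<in>F. upoly y (f i))"
  by (induction F rule: infinite_finite_induct) (simp_all add: upoly_add)

lemma upoly_smult: "upoly y (smult c f) = umult csc (0, c) (upoly y f)"
proof (induction f)
  case (pCons a p)
  have "umult csc (y, 0) (umult csc (0, c) x) = umult csc (0, c) (umult csc (y, 0) x)" for x
    by (cases x) (simp add: umult_pair csc_mult_right csc.scale_right_distrib mult.commute)
  then show ?case
    by (simp add: upoly_pCons pCons umult_right.add) (simp add: umult_pair)
qed simp

lemma upoly_mult: "upoly y (f * g) = umult csc (upoly y f) (upoly y g)"
proof (induction f)
  case (pCons a p)
  have "upoly y (pCons a p * g) = umult csc (0, a) (upoly y g) + umult csc (y, 0) (upoly y (p * g))"
    by (simp add: upoly_add upoly_smult upoly_pCons flip: zero_prod_def)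
  then show ?case
    by (simp add: pCons upoly_pCons umult_left.add umult_assoc)
qed simp

lemma upoly_map_cnj:
  assumes y: "star y = y"
  shows "upoly y (map_poly cnj f) = ustar star (upoly y f)"
proof (induction f)
  case (pCons a p)
  define g where "g = map_poly cnj p"
  have "upoly y ([:0, 1:] * g) = upoly y (g * [:0, 1:])" by (simp only: mult.commute)
  then have "umult csc (y, 0) (upoly y g) = umult csc (upoly y g) (y, 0)"
    unfolding upoly_mult by (simp add: upoly_linear)
  moreover have "ustar star (y, 0) = (y, 0)" "ustar star (0, a) = (0, cnj a)"
    by (simp_all add: ustar_def y star.zero)
  ultimately show ?case
    using pCons by (simp add: map_poly_pCons upoly_pCons ustar_umult ustar.add g_def)
qed simp

lemma uinvertible_upoly:
  assumes "\<And>\<mu>. \<mu> \<in> uspectrum csc y \<Longrightarrow> poly f \<mu> \<noteq> 0"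
  shows "uinvertible csc (upoly y f)"
proof -
  have "f \<noteq> 0" using assms[OF zero_in_uspectrum] by auto
  then obtain A where f: "f = smult (lead_coeff f) (\<Prod>\<mu>\<in>#A. [:- \<mu>, 1:])"
    using alg_closed_imp_factorization by blast
  have const: "uinvertible csc (0, c)" if "c \<noteq> 0" for c
    unfolding uinvertible_def using that by (intro exI[of _ "(0, 1 / c)"]) (simp add: umult_pair)
  have "poly f \<mu> = 0" if "\<mu> \<in># A" for \<mu>
    by (subst f) (use that in \<open>auto simp: poly_prod_mset prod_mset_zero_iff\<close>)
  then have "\<mu> \<notin> uspectrum csc y" if "\<mu> \<in># A" for \<mu>
    using assms that by blast
  then have "uinvertible csc (upoly y (\<Prod>\<mu>\<in>#A. [:- \<mu>, 1:]))"
  proof (induction A)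
    case empty
    show ?case using const[of 1] by (simp add: upoly_const flip: pCons_one)
  next
    case (add \<mu> A)
    then have "uinvertible csc (upoly y [:- \<mu>, 1:])"
      by (simp add: upoly_linear uspectrum_def)
    then show ?case
      unfolding image_mset_add_mset prod_mset.add_mset upoly_mult
      using add by (intro uinvertible_umult) auto
  qed
  then show ?thesis
    using const[of "lead_coeff f"] \<open>f \<noteq> 0\<close> by (subst f) (simp add: upoly_smult uinvertible_umult)
qed

lemma upoly_eq_0:
  assumes y: "star y = y" and f: "\<And>\<mu>. \<mu> \<in> uspectrum csc y \<Longrightarrow> poly f \<mu> = 0"
  shows "upoly y f = 0"
proof -
  have "snd (upoly y f) = 0" using f[OF zero_in_uspectrum] by (simp add: snd_upoly)
  then obtain a where a: "upoly y f = (a, 0)" by (metis prod.collapse)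
  define k where "k = star a * a"
  have k: "upoly y (map_poly cnj f * f) = (k, 0)"
    by (simp add: upoly_mult upoly_map_cnj[OF y] a ustar_def umult_pair k_def)
  have "k = 0"
  proof (rule selfadjoint_quasinilpotent_eq_0)
    show "star k = k" by (simp add: k_def star_mult star_star)
    fix z
    have "uinvertible csc (upoly y ([:1:] + smult (- z) (map_poly cnj f * f)))"
      by (rule uinvertible_upoly) (simp add: f)
    then have "uinvertible csc (- csc z k, 1)"
      by (simp add: upoly_add upoly_const upoly_smult k umult_pair
          del: mult_pCons_left smult_minus_left)
    then show "\<exists>w. quasi_inverse (csc z k) w" by (rule uinvertible_imp_quasi_inverse)
  qed
  then show ?thesis by (simp add: a k_def star_mult_self_eq_0_iff zero_prod_def)
qed

lemma upoly_cong:
  assumes "star y = y" and "\<And>\<mu>. \<mu> \<in> uspectrum csc y \<Longrightarrow> poly f \<mu> = poly g \<mu>"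
  shows "upoly y f = upoly y g"
proof -
  have "upoly y (f - g) = 0" by (rule upoly_eq_0) (simp_all add: assms)
  then show ?thesis using upoly_add[of y "f - g" g] by simp
qed

definition spectral_component :: "'a \<Rightarrow> complex \<Rightarrow> 'a" where
  "spectral_component y \<nu> = fst (upoly y (lagrange_poly (uspectrum csc y) \<nu>))"

context
  fixes y
  assumes selfadjoint: "star y = y" and finite_spectrum: "finite (uspectrum csc y)"
begin

lemma upoly_lagrange_poly:
  assumes "\<nu> \<noteq> 0"
  shows "upoly y (lagrange_poly (uspectrum csc y) \<nu>) = (spectral_component y \<nu>, 0)"
  using assms poly_lagrange_poly[OF finite_spectrum zero_in_uspectrum]
  by (simp add: prod_eq_iff snd_upoly spectral_component_def)

lemma spectral_component_mult:
  assumes "\<nu> \<noteq> 0" "\<mu> \<noteq> 0"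
  shows "spectral_component y \<nu> * spectral_component y \<mu>
    = (if \<nu> = \<mu> then spectral_component y \<nu> else 0)"
proof -
  let ?L = "lagrange_poly (uspectrum csc y)"
  have "upoly y (?L \<nu> * ?L \<mu>) = upoly y (if \<nu> = \<mu> then ?L \<nu> else 0)"
    by (rule upoly_cong[OF selfadjoint]) (simp add: poly_lagrange_poly[OF finite_spectrum])
  then show ?thesis
    using assms
    by (auto simp: upoly_mult upoly_lagrange_poly umult_pair zero_prod_def split: if_splits)
qed

lemma star_spectral_component:
  assumes "\<nu> \<noteq> 0"
  shows "star (spectral_component y \<nu>) = spectral_component y (cnj \<nu>)"
proof -
  let ?L = "lagrange_poly (uspectrum csc y)"
  have "cnj \<mu> = \<nu> \<longleftrightarrow> \<mu> = cnj \<nu>" for \<mu>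
    by (metis complex_cnj_cnj)
  then have "upoly y (map_poly cnj (?L \<nu>)) = upoly y (?L (cnj \<nu>))"
    by (intro upoly_cong[OF selfadjoint])
      (simp add: poly_lagrange_poly[OF finite_spectrum] cnj_in_uspectrum[OF selfadjoint])
  then show ?thesis
    using assms by (simp add: upoly_map_cnj[OF selfadjoint] upoly_lagrange_poly ustar_def)
qed

lemma spectral_component_nonreal:
  assumes "cnj \<nu> \<noteq> \<nu>"
  shows "spectral_component y \<nu> = 0"
proof -
  have "\<nu> \<noteq> 0" using assms by auto
  then have "star (spectral_component y \<nu>) * spectral_component y \<nu> = 0"
    using assms by (simp add: star_spectral_component spectral_component_mult)
  then show ?thesis by (simp add: star_mult_self_eq_0_iff)
qed

lemma sum_spectral_components:
  "(\<Sum>\<nu>\<in>uspectrum csc y - {0}. csc \<nu> (spectral_component y \<nu>)) = y"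
proof -
  let ?S = "uspectrum csc y"
  have "upoly y [:0, 1:] = upoly y (\<Sum>\<nu>\<in>?S - {0}. smult \<nu> (lagrange_poly ?S \<nu>))"
  proof (rule upoly_cong[OF selfadjoint])
    fix \<mu> assume \<mu>: "\<mu> \<in> ?S"
    have "(\<Sum>\<nu>\<in>?S - {0}. \<nu> * poly (lagrange_poly ?S \<nu>) \<mu>) = (\<Sum>\<nu>\<in>?S - {0}. if \<nu> = \<mu> then \<mu> else 0)"
      using \<mu> by (intro sum.cong) (auto simp: poly_lagrange_poly[OF finite_spectrum])
    also have "\<dots> = \<mu>" using finite_spectrum \<mu> by simp
    finally show "poly [:0, 1:] \<mu> = poly (\<Sum>\<nu>\<in>?S - {0}. smult \<nu> (lagrange_poly ?S \<nu>)) \<mu>"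
      by (simp add: poly_sum)
  qed
  also have "\<dots> = (\<Sum>\<nu>\<in>?S - {0}. (csc \<nu> (spectral_component y \<nu>), 0))"
    unfolding upoly_sum by (intro sum.cong refl) (simp add: upoly_smult upoly_lagrange_poly umult_pair)
  finally show ?thesis
    by (simp add: upoly_linear prod_eq_iff fst_sum)
qed

lemma finite_spectrum_decomposition:
  "\<exists>F e. orth_proj_family F e \<and> y = orth_sum F e (\<lambda>l. l)"
proof -
  define F where "F = {l::real. l \<noteq> 0 \<and> complex_of_real l \<in> uspectrum csc y}"
  define e where "e l = spectral_component y (complex_of_real l)" for l
  have F_subset: "complex_of_real ` F \<subseteq> uspectrum csc y - {0}" by (auto simp: F_def)
  have "finite F"
    using finite_subset[OF F_subset] finite_spectrum by (simp add: finite_image_iff inj_on_def)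
  then have "orth_proj_family F e"
    by (auto simp: orth_proj_family_def proj_def e_def F_def star_spectral_component
        spectral_component_mult)
  moreover have "cnj \<nu> \<noteq> \<nu>" if "\<nu> \<in> uspectrum csc y - {0} - complex_of_real ` F" for \<nu>
  proof
    assume "cnj \<nu> = \<nu>"
    then have "\<nu> = complex_of_real (Re \<nu>)" by (simp add: complex_eq_iff)
    then show False
      using that unfolding F_def
      by (metis (mono_tags, lifting) DiffE image_eqI mem_Collect_eq of_real_0 singletonI)
  qed
  then have "y = (\<Sum>\<nu>\<in>complex_of_real ` F. csc \<nu> (spectral_component y \<nu>))"
    using spectral_component_nonreal finite_spectrum F_subset
    by (subst sum_spectral_components[symmetric], intro sum.mono_neutral_right) auto
  then have "y = orth_sum F e (\<lambda>l. l)"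
    by (simp add: sum.reindex inj_on_def csc_of_real e_def orth_sum_def)
  ultimately show ?thesis by blast
qed

end

lemma ex_orth_sum_approx:
  assumes "real_rank_zero csc star" "star x = x" "\<epsilon> > 0"
  shows "\<exists>F e. orth_proj_family F e \<and> (\<forall>l\<in>F. e l \<noteq> 0) \<and> norm (x - orth_sum F e (\<lambda>l. l)) < \<epsilon>"
proof -
  obtain y where y: "star y = y" "finite (uspectrum csc y)" "norm (x - y) < \<epsilon>"
    using assms unfolding real_rank_zero_def by blast
  obtain F e where fam: "orth_proj_family F e" and y_eq: "y = orth_sum F e (\<lambda>l. l)"
    using finite_spectrum_decomposition[OF y(1,2)] by blast
  define G where "G = {l\<in>F. e l \<noteq> 0}"
  have "finite F" using fam by (simp add: orth_proj_family_def)
  then have "orth_sum F e (\<lambda>l. l) = orth_sum G e (\<lambda>l. l)"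
    unfolding orth_sum_def by (rule sum.mono_neutral_right) (auto simp: G_def)
  moreover have "orth_proj_family G e"
    using fam by (rule orth_proj_family_subset) (simp add: G_def)
  ultimately show ?thesis
    using y(3) y_eq by (intro exI[of _ G] exI[of _ e]) (auto simp: G_def)
qed

end

section \<open>Approximate supports\<close>

context cstar
begin

lemma ex_orth_sum_cutoff:
  assumes fam: "orth_proj_family F e" and \<delta>: "\<delta> > 0" and lower: "\<And>i. i \<in> F \<Longrightarrow> - \<delta> \<le> l i"
  defines "y \<equiv> orth_sum F e l"
  shows "\<exists>r x. proj star r \<and> star x = x \<and> x * r = x \<and> x * y * x = r \<and>
    norm x \<le> 1 / sqrt \<delta> \<and> norm (y - y * r) \<le> \<delta>"
proof (intro exI conjI)
  define \<rho> where "\<rho> i = (if \<delta> < l i then 1 else 0 :: real)" for i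
  define \<tau> where "\<tau> i = (if \<delta> < l i then 1 / sqrt (l i) else 0)" for i
  let ?r = "orth_sum F e \<rho>" and ?x = "orth_sum F e \<tau>"
  have "(\<lambda>i. \<rho> i * \<rho> i) = \<rho>" by (auto simp: \<rho>_def)
  then show "proj star ?r"
    by (simp add: proj_def star_orth_sum[OF fam] orth_sum_mult[OF fam])
  show "star ?x = ?x" by (rule star_orth_sum[OF fam])
  have "(\<lambda>i. \<tau> i * \<rho> i) = \<tau>" by (auto simp: \<tau>_def \<rho>_def)
  then show "?x * ?r = ?x" by (simp add: orth_sum_mult[OF fam])
  have "(\<lambda>i. \<tau> i * l i * \<tau> i) = \<rho>"
    using \<delta> by (auto simp: \<tau>_def \<rho>_def fun_eq_iff)
  then show "?x * y * ?x = ?r" by (simp add: y_def orth_sum_mult[OF fam])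
  show "norm ?x \<le> 1 / sqrt \<delta>"
    using \<delta> by (intro norm_orth_sum_le[OF fam]) (auto simp: \<tau>_def frac_le)
  have "y - y * ?r = orth_sum F e (\<lambda>i. l i - l i * \<rho> i)"
    by (simp add: y_def orth_sum_mult[OF fam])
      (simp add: orth_sum_def scaleR_diff_left sum_subtractf)
  also have "norm \<dots> \<le> \<delta>"
    using \<delta> lower by (intro norm_orth_sum_le[OF fam]) (force simp: \<rho>_def abs_le_iff)+
  finally show "norm (y - y * ?r) \<le> \<delta>" .
qed

lemma ex_spectral_cutoff:
  assumes z: "star z = z" and fam: "orth_proj_family F e"
    and near: "norm (z - orth_sum F e l) < \<delta>" and lower: "\<And>i. i \<in> F \<Longrightarrow> - \<delta> \<le> l i"
  shows "\<exists>r t. proj star r \<and> norm (z - z * r) \<le> 2 * \<delta> \<and> star t * z * t = r"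
proof -
  have \<delta>: "\<delta> > 0" using near norm_ge_zero le_less_trans by blast
  define y where "y = orth_sum F e l"
  obtain r x where r: "proj star r" and x: "star x = x" "x * r = x" "x * y * x = r"
    and norm_x: "norm x \<le> 1 / sqrt \<delta>" and yr: "norm (y - y * r) \<le> \<delta>"
    using ex_orth_sum_cutoff[OF fam \<delta>, of l] lower unfolding y_def by blast
  have "star x * z * x - r = x * (z - y) * x"
    by (simp add: x(1) x(3)[symmetric] algebra_simps)
  also have "norm \<dots> \<le> norm x * norm (z - y) * norm x"
    by (intro order_trans[OF norm_mult_ineq] mult_right_mono norm_mult_ineq norm_ge_zero)
  also have "\<dots> \<le> 1 / sqrt \<delta> * norm (z - y) * (1 / sqrt \<delta>)"
    using norm_x \<delta> by (intro mult_mono) auto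
  also have "\<dots> < 1" using near \<delta> by (simp add: y_def)
  finally obtain t where t: "star t * z * t = r"
    using ex_factor_of_near_proj[OF r z x(2)] by blast
  have "norm ((y - y * r) + ((z - y) - (z - y) * r)) \<le> \<delta> + \<delta>"
    using yr near norm_diff_proj_right[OF r, of "z - y"]
    by (intro norm_triangle_mono) (auto simp: y_def)
  then have "norm (z - z * r) \<le> 2 * \<delta>" by (simp add: algebra_simps)
  then show ?thesis using r t by blast
qed

lemma proj_mult_orthogonal_sum:
  assumes "proj star q" "c * q = 0"
  shows "q * (star c * c + q) = q"
proof -
  have "q * star c = 0"
    using arg_cong[OF assms(2), of star] by (simp add: star_mult proj_star[OF assms(1)] star.zero)
  then show ?thesis by (simp add: distrib_left proj_idem[OF assms(1)] flip: mult.assoc)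
qed

lemma eigenvalue_ge_minus_norm_diff:
  assumes q: "proj star q" and cq: "c * q = 0"
    and e: "proj star e" "e \<noteq> 0" and eigen: "y * e = l *\<^sub>R e"
  shows "- (2 * norm (star c * c + q - y)) \<le> l"
proof (cases "0 \<le> l")
  case False
  define z where "z = star c * c + q"
  define d where "d = z * e - l *\<^sub>R e"
  have "d = (z - y) * e" by (simp add: d_def left_diff_distrib eigen)
  then have d: "norm d \<le> norm (z - y)"
    by (simp add: norm_mult_proj_le[OF e(1)])
  have "q * d = (1 - l) *\<^sub>R (q * e)"
    by (simp add: d_def z_def right_diff_distrib scaleR_diff_left
        proj_mult_orthogonal_sum[OF q cq] flip: mult.assoc)
  then have "(1 - l) * norm (q * e) = norm (q * d)" using False by simp
  also have "\<dots> \<le> norm d" by (rule norm_proj_mult_le[OF q])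
  finally have "norm (q * e) \<le> norm d"
    using False mult_right_mono[of 1 "1 - l" "norm (q * e)"] by simp
  have "- l \<le> norm (e * (star c * c) * e - l *\<^sub>R e)"
    by (rule norm_corner_star_mult_self_diff_ge[OF e])
  also have "e * (star c * c) * e - l *\<^sub>R e = e * (d - q * e)"
    by (simp add: d_def z_def algebra_simps proj_idem[OF e(1)])
  also have "norm \<dots> \<le> norm (d - q * e)" by (rule norm_proj_mult_le[OF e(1)])
  also have "\<dots> \<le> 2 * norm (z - y)"
    using norm_triangle_ineq4[of d "q * e"] d \<open>norm (q * e) \<le> norm d\<close> by simp
  finally show ?thesis by (simp add: z_def)
qed (use norm_ge_zero[of "star c * c + q - y"] in linarith)

lemma norm_diff_proj_orthogonal_summands:
  assumes q: "proj star q" and cq: "c * q = 0" and r: "proj star r"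
  defines "z \<equiv> star c * c + q"
  shows "norm (q - q * r) \<le> norm (z - z * r)"
    and "(norm (c - c * r))\<^sup>2 \<le> 2 * norm (z - z * r)"
proof -
  have "q - q * r = q * (z - z * r)"
    unfolding z_def
    by (simp add: right_diff_distrib proj_mult_orthogonal_sum[OF q cq] flip: mult.assoc)
  then show q_le: "norm (q - q * r) \<le> norm (z - z * r)"
    by (simp only: norm_proj_mult_le[OF q])
  define x where "x = star c * c - star c * c * r"
  have "star (c - c * r) * (c - c * r) = x - r * x"
    by (simp add: x_def star.diff star_mult proj_star[OF r] algebra_simps)
  then have "(norm (c - c * r))\<^sup>2 = norm (x - r * x)" by (metis norm_star_mult_self)
  also have "\<dots> \<le> norm x" by (rule norm_diff_proj_left[OF r])
  also have "x = (z - z * r) - (q - q * r)" by (simp add: x_def z_def algebra_simps)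
  also have "norm \<dots> \<le> 2 * norm (z - z * r)"
    using q_le norm_triangle_ineq4[of "z - z * r" "q - q * r"] by simp
  finally show "(norm (c - c * r))\<^sup>2 \<le> 2 * norm (z - z * r)" .
qed

lemma ex_approximate_support:
  assumes rr: "real_rank_zero csc star" and q: "proj star q" and cq: "c * q = 0" and "\<eta> > 0"
  shows "\<exists>r t. proj star r \<and> norm (c - c * r) \<le> \<eta> \<and> norm (q - q * r) \<le> \<eta> \<and>
    star t * (star c * c + q) * t = r"
proof -
  define \<delta> where "\<delta> = min (\<eta> / 2) (\<eta>\<^sup>2 / 4)"
  have \<delta>: "\<delta> > 0" "2 * \<delta> \<le> \<eta>" "4 * \<delta> \<le> \<eta>\<^sup>2" using \<open>\<eta> > 0\<close> by (simp_all add: \<delta>_def min_def)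
  define z where "z = star c * c + q"
  have z: "star z = z" by (simp add: z_def star.add star_mult star_star proj_star[OF q])
  obtain F e where fam: "orth_proj_family F e" and e: "\<forall>l\<in>F. e l \<noteq> 0"
    and near: "norm (z - orth_sum F e (\<lambda>l. l)) < \<delta> / 2"
    using ex_orth_sum_approx[OF rr z, of "\<delta> / 2"] \<delta>(1) by auto
  have "- \<delta> \<le> l" if "l \<in> F" for l
    using eigenvalue_ge_minus_norm_diff[OF q cq _ _ orth_sum_mult_proj[OF fam that, of "\<lambda>l. l"]]
      fam e near that by (force simp: orth_proj_family_def z_def)
  then obtain r t where r: "proj star r" and zr: "norm (z - z * r) \<le> 2 * \<delta>"
    and t: "star t * z * t = r"
    using ex_spectral_cutoff[OF z fam, of "\<lambda>l. l" \<delta>] near \<delta>(1) by auto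
  have "norm (q - q * r) \<le> \<eta>" "(norm (c - c * r))\<^sup>2 \<le> \<eta>\<^sup>2"
    using norm_diff_proj_orthogonal_summands[OF q cq r] zr \<delta> unfolding z_def by linarith+
  moreover from this(2) have "norm (c - c * r) \<le> \<eta>"
    using \<open>\<eta> > 0\<close> by (simp add: power2_le_iff_abs_le)
  ultimately show ?thesis using r t unfolding z_def by blast
qed

end

section \<open>Comparison of projections in matrix algebras\<close>

lemma sum_lessThan_add:
  fixes f :: "nat \<Rightarrow> 'b::comm_monoid_add"
  shows "(\<Sum>k<n + m. f k) = (\<Sum>k<n. f k) + (\<Sum>k<m. f (n + k))"
  by (induction m) (simp_all add: add.assoc)

definition mstack :: "nat \<Rightarrow> (nat \<Rightarrow> nat \<Rightarrow> 'b) \<Rightarrow> (nat \<Rightarrow> nat \<Rightarrow> 'b) \<Rightarrow> nat \<Rightarrow> nat \<Rightarrow> 'b" where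
  "mstack n X Y i j = (if i < n then X i j else Y (i - n) j)"

lemma msupp_iff: "msupp n X \<longleftrightarrow> (\<forall>i j. n \<le> i \<or> n \<le> j \<longrightarrow> X i j = 0)"
  by (simp add: msupp_def zero_prod_def)

lemma dsum_eq: "dsum n X m Y i j =
    (if i < n \<and> j < n then X i j else if n \<le> i \<and> n \<le> j then Y (i - n) (j - n) else 0)"
  by (simp add: dsum_def zero_prod_def)

lemma msupp_dsum: "msupp m Y \<Longrightarrow> msupp (n + m) (dsum n X m Y)"
  unfolding msupp_iff dsum_eq by (simp add: le_diff_conv2)

lemma in_A_dsum: "in_A X \<Longrightarrow> in_A Y \<Longrightarrow> in_A (dsum n X m Y)"
  by (simp add: in_A_def dsum_def)

lemma in_A_mstack: "in_A X \<Longrightarrow> in_A Y \<Longrightarrow> in_A (mstack n X Y)"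
  by (simp add: in_A_def mstack_def)

lemma in_A_diff: "in_A X \<Longrightarrow> in_A Y \<Longrightarrow> in_A (X - Y)"
  by (simp add: in_A_def)

lemma in_A_mstar: "in_A X \<Longrightarrow> in_A (mstar star X)"
  by (simp add: in_A_def mstar_def ustar_def)

lemma in_A_mmul: "in_A X \<Longrightarrow> in_A (mmul csc n X Y)"
  by (simp add: in_A_def mmul_def umult_def snd_sum)

lemma mat1_add: "mat1 x + mat1 y = mat1 (x + y :: 'b::comm_monoid_add)"
  by (auto simp: fun_eq_iff mat1_def)

context cstar
begin

lemmas umult_distribs =
  umult_left.diff umult_right.diff umult_left.sum umult_right.sum

lemma mmul_assoc: "mmul csc n (mmul csc m X Y) Z = mmul csc m X (mmul csc n Y Z)"
proof (intro ext)
  fix i j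
  have "mmul csc n (mmul csc m X Y) Z i j
      = (\<Sum>k<n. \<Sum>l<m. umult csc (X i l) (umult csc (Y l k) (Z k j)))"
    by (simp add: mmul_def umult_distribs umult_assoc)
  also have "\<dots> = mmul csc m X (mmul csc n Y Z) i j"
    by (subst sum.swap) (simp add: mmul_def umult_distribs)
  finally show "mmul csc n (mmul csc m X Y) Z i j = mmul csc m X (mmul csc n Y Z) i j" .
qed

lemma mmul_diff_left: "mmul csc n (X - Y) Z = mmul csc n X Z - mmul csc n Y Z"
  and mmul_diff_right: "mmul csc n Z (X - Y) = mmul csc n Z X - mmul csc n Z Y"
  by (simp_all add: fun_eq_iff mmul_def umult_distribs sum_subtractf)

lemma mmul_extend:
  assumes "n \<le> N" "\<And>i j k. n \<le> k \<Longrightarrow> X i k = 0 \<or> Y k j = 0"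
  shows "mmul csc N X Y = mmul csc n X Y"
  unfolding mmul_def
  using assms by (intro ext sum.mono_neutral_right) (auto, metis umult_left.zero umult_right.zero)

lemma mmul_eq_self_imp_row_eq_0:
  assumes "msupp n P" "mmul csc n P V = V" "n \<le> i"
  shows "V i j = 0"
  using assms(1,3) by (subst assms(2)[symmetric]) (simp add: mmul_def msupp_iff)

lemma mmul_eq_self_imp_column_eq_0:
  assumes "msupp m Q" "mmul csc m V Q = V" "m \<le> j"
  shows "V i j = 0"
  using assms(1,3) by (subst assms(2)[symmetric]) (simp add: mmul_def msupp_iff)

lemma mstar_mstar: "mstar star (mstar star X) = X"
  by (simp add: fun_eq_iff mstar_def ustar_ustar)

lemma mstar_diff: "mstar star (X - Y) = mstar star X - mstar star Y"
  by (simp add: fun_eq_iff mstar_def ustar.diff)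

lemma mstar_mmul: "mstar star (mmul csc n X Y) = mmul csc n (mstar star Y) (mstar star X)"
  by (simp add: fun_eq_iff mstar_def mmul_def ustar.sum ustar_umult)

lemma mmul_dsum: "mmul csc (n + m) (dsum n X m Y) (dsum n X' m Y')
    = dsum n (mmul csc n X X') m (mmul csc m Y Y')"
  by (auto simp: fun_eq_iff mmul_def dsum_eq sum_lessThan_add)

lemma mstar_dsum: "mstar star (dsum n X m Y) = dsum n (mstar star X) m (mstar star Y)"
  by (auto simp: fun_eq_iff mstar_def dsum_eq)

lemma mmul_dsum_mstack: "mmul csc (n + m) (dsum n X m Y) (mstack n V W)
    = mstack n (mmul csc n X V) (mmul csc m Y W)"
  by (auto simp: fun_eq_iff mmul_def dsum_eq mstack_def sum_lessThan_add)

lemma mmul_mstar_mstack: "mmul csc (n + m) (mstar star (mstack n V W)) (mstack n V W)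
    = mmul csc n (mstar star V) V + mmul csc m (mstar star W) W"
  by (simp add: fun_eq_iff mmul_def mstar_def mstack_def sum_lessThan_add)

lemma mmul_mstack_mstar:
  assumes "mmul csc n X (mstar star Y) = 0" "mmul csc n Y (mstar star X) = 0"
  shows "mmul csc n (mstack m X Y) (mstar star (mstack m X Y))
    = dsum m (mmul csc n X (mstar star X)) k (mmul csc n Y (mstar star Y))"
proof (intro ext)
  fix i j
  have "mmul csc n (mstack m X Y) (mstar star (mstack m X Y)) i j =
      (if i < m then
         if j < m then mmul csc n X (mstar star X) i j else mmul csc n X (mstar star Y) i (j - m)
       else if j < m then mmul csc n Y (mstar star X) (i - m) j
       else mmul csc n Y (mstar star Y) (i - m) (j - m))"
    by (simp add: mmul_def mstar_def mstack_def)
  then show "mmul csc n (mstack m X Y) (mstar star (mstack m X Y)) i j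
      = dsum m (mmul csc n X (mstar star X)) k (mmul csc n Y (mstar star Y)) i j"
    by (simp add: assms dsum_eq)
qed

lemma mmul_mat1: "mmul csc 1 (mat1 x) (mat1 y) = mat1 (x * y)"
  by (auto simp: fun_eq_iff mmul_def mat1_def umult_pair simp flip: zero_prod_def)

lemma mstar_mat1: "mstar star (mat1 x) = mat1 (star x)"
  by (auto simp: fun_eq_iff mstar_def mat1_def ustar_def star.zero)

lemma is_proj_msupp: "is_proj csc star n P \<Longrightarrow> msupp n P"
  and is_proj_mstar: "is_proj csc star n P \<Longrightarrow> mstar star P = P"
  and is_proj_idem: "is_proj csc star n P \<Longrightarrow> mmul csc n P P = P"
  and is_proj_in_A: "is_proj csc star n P \<Longrightarrow> in_A P"
  by (simp_all add: is_proj_def is_uproj_def)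

lemma is_proj_dsum:
  assumes "is_proj csc star n P" "is_proj csc star m Q"
  shows "is_proj csc star (n + m) (dsum n P m Q)"
  using assms by (simp add: is_proj_def is_uproj_def msupp_dsum in_A_dsum mmul_dsum mstar_dsum)

lemma is_proj_mat1: "proj star p \<Longrightarrow> is_proj csc star 1 (mat1 p)"
  using mmul_mat1[of p p]
  by (auto simp: is_proj_def is_uproj_def mstar_mat1 proj_star proj_idem msupp_def in_A_def mat1_def)

definition mvn_le :: "(nat \<Rightarrow> nat \<Rightarrow> 'a \<times> complex) \<Rightarrow> nat \<Rightarrow> (nat \<Rightarrow> nat \<Rightarrow> 'a \<times> complex) \<Rightarrow> bool" where
  "mvn_le Q n P \<longleftrightarrow> (\<exists>V. in_A V \<and> mmul csc n P V = V \<and> mmul csc n (mstar star V) V = Q)"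

lemma mvn_leE:
  assumes "mvn_le Q n P" "is_proj csc star m Q"
  obtains V where "in_A V" "mmul csc n P V = V" "mmul csc n (mstar star V) V = Q" "mmul csc m V Q = V"
proof -
  obtain W where W: "in_A W" "mmul csc n P W = W" "mmul csc n (mstar star W) W = Q"
    using assms(1) unfolding mvn_le_def by blast
  define V where "V = mmul csc m W Q"
  have "mmul csc n (mstar star V) V
      = mmul csc m Q (mmul csc m (mmul csc n (mstar star W) W) Q)"
    by (simp add: V_def mstar_mmul is_proj_mstar[OF assms(2)] mmul_assoc)
  also have "\<dots> = Q" by (simp only: W(3) is_proj_idem[OF assms(2)])
  finally have "mmul csc n (mstar star V) V = Q" .
  moreover have "mmul csc n P V = V" by (simp add: V_def W(2) flip: mmul_assoc)
  moreover have "mmul csc m V Q = V" by (simp add: V_def mmul_assoc is_proj_idem[OF assms(2)])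
  moreover have "in_A V" unfolding V_def using W(1) by (rule in_A_mmul)
  ultimately show ?thesis using that by blast
qed

lemma mvn_le_compress:
  assumes "mvn_le Q n P"
  shows "mvn_le (mmul csc k (mstar star Y) (mmul csc k Q Y)) n P"
proof -
  obtain V where V: "in_A V" "mmul csc n P V = V" "mmul csc n (mstar star V) V = Q"
    using assms unfolding mvn_le_def by blast
  have "mmul csc n P (mmul csc k V Y) = mmul csc k V Y"
    by (simp add: V(2) flip: mmul_assoc)
  moreover have "mmul csc n (mstar star (mmul csc k V Y)) (mmul csc k V Y)
      = mmul csc k (mstar star Y) (mmul csc k (mmul csc n (mstar star V) V) Y)"
    by (simp add: mstar_mmul mmul_assoc)
  ultimately show ?thesis
    unfolding mvn_le_def using V(1,3) in_A_mmul by (metis (no_types))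
qed

lemma mvn_le_mat1_compress: "mvn_le (mat1 x) n P \<Longrightarrow> mvn_le (mat1 (star y * x * y)) n P"
  using mvn_le_compress[of "mat1 x" n P 1 "mat1 y"]
  by (simp only: mstar_mat1 mmul_mat1 mult.assoc)

lemma mvn_le_dsum:
  assumes "mvn_le Q n P" "mvn_le Q' m P'"
  shows "mvn_le (Q + Q') (n + m) (dsum n P m P')"
proof -
  obtain V W where "in_A V" "mmul csc n P V = V" "mmul csc n (mstar star V) V = Q"
    and "in_A W" "mmul csc m P' W = W" "mmul csc m (mstar star W) W = Q'"
    using assms unfolding mvn_le_def by blast
  then show ?thesis
    unfolding mvn_le_def
    by (intro exI[of _ "mstack n V W"]) (simp add: in_A_mstack mmul_dsum_mstack mmul_mstar_mstack)
qed

lemma mvn_complement: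
  assumes P: "is_proj csc star n P" and Q: "is_proj csc star m Q"
    and V: "in_A V" "mmul csc n P V = V" "mmul csc n (mstar star V) V = Q" "mmul csc m V Q = V"
  defines "R \<equiv> P - mmul csc m V (mstar star V)"
  shows "is_proj csc star n R" "mmul csc n (mstar star V) R = 0" "mmul csc n R V = 0"
proof -
  have V'P: "mmul csc n (mstar star V) P = mstar star V"
    using arg_cong[OF V(2), of "mstar star"] by (simp add: mstar_mmul is_proj_mstar[OF P])
  have QV': "mmul csc m Q (mstar star V) = mstar star V"
    using arg_cong[OF V(4), of "mstar star"] by (simp add: mstar_mmul is_proj_mstar[OF Q])
  show V'R: "mmul csc n (mstar star V) R = 0"
    by (simp add: R_def mmul_diff_right V'P V(3) QV' flip: mmul_assoc)
  have R_star: "mstar star R = R"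
    by (simp add: R_def mstar_diff mstar_mmul mstar_mstar is_proj_mstar[OF P])
  show "mmul csc n R V = 0"
    by (simp add: R_def mmul_diff_left mmul_assoc V)
  have "mmul csc n P R = R"
    by (simp add: R_def mmul_diff_right is_proj_idem[OF P] V(2) flip: mmul_assoc)
  moreover have "mmul csc n (mmul csc m V (mstar star V)) R = 0"
    by (simp add: mmul_assoc V'R) (simp add: fun_eq_iff mmul_def)
  ultimately have "mmul csc n R R = R"
    by (subst (1) R_def) (simp add: mmul_diff_left)
  moreover have "msupp n R"
    using is_proj_msupp[OF P] mmul_eq_self_imp_row_eq_0[OF is_proj_msupp[OF P] V(2)]
    by (auto simp: msupp_iff R_def mmul_def mstar_def)
  ultimately show "is_proj csc star n R"
    using R_star V(1) is_proj_in_A[OF P]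
    by (simp add: is_proj_def is_uproj_def R_def in_A_diff in_A_mmul)
qed

lemma k0_le_of_mvn_le:
  assumes canc: "has_cancellation csc star"
    and P: "is_proj csc star n P" and Q: "is_proj csc star m Q" and le: "mvn_le Q n P"
  shows "k0_le csc star m Q n P"
proof -
  obtain V where V: "in_A V" "mmul csc n P V = V" "mmul csc n (mstar star V) V = Q" "mmul csc m V Q = V"
    using mvn_leE[OF le Q] by blast
  define R where "R = P - mmul csc m V (mstar star V)"
  note R = mvn_complement[OF P Q V, folded R_def]
  have R_star: "mstar star R = R" and R_idem: "mmul csc n R R = R" and R_supp: "msupp n R"
    by (fact is_proj_mstar[OF R(1)] is_proj_idem[OF R(1)] is_proj_msupp[OF R(1)])+
  have V_row: "n \<le> i \<Longrightarrow> V i j = 0" and V_column: "m \<le> j \<Longrightarrow> V i j = 0" for i j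
    by (fact mmul_eq_self_imp_row_eq_0[OF is_proj_msupp[OF P] V(2)]
        mmul_eq_self_imp_column_eq_0[OF is_proj_msupp[OF Q] V(4)])+
  define S where "S = mstack m (mstar star V) R"
  have S_column: "S i k = 0" if "n \<le> k" for i k
    using that V_row R_supp by (simp add: S_def mstack_def mstar_def msupp_iff)
  have "mvn_A csc star (m + n) (dsum m Q n R) n P"
    unfolding mvn_A_def
  proof (intro exI conjI)
    show "msupp (m + n) (mstar star S)"
      using S_column V_column R_supp by (auto simp: msupp_iff mstar_def S_def mstack_def)
    show "in_A (mstar star S)"
      unfolding S_def using V(1) is_proj_in_A[OF R(1)] by (intro in_A_mstar in_A_mstack)
    have "mmul csc (m + n) S (mstar star S) = mmul csc n S (mstar star S)"
      using S_column by (intro mmul_extend) auto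
    also have "\<dots> = dsum m Q n R"
      unfolding S_def
      by (subst mmul_mstack_mstar) (simp_all add: mstar_mstar R_star R_idem R(2,3) V(3))
    finally show "mmul csc (m + n) (mstar star (mstar star S)) (mstar star S) = dsum m Q n R"
      by (simp only: mstar_mstar)
    show "mmul csc (m + n) (mstar star S) (mstar star (mstar star S)) = P"
      by (simp add: mstar_mstar S_def mmul_mstar_mstack R_star R_idem) (simp add: R_def)
  qed auto
  then have "k0_eq csc star (m + n) (dsum m Q n R) n P"
    using canc is_proj_dsum[OF Q R(1)] P unfolding has_cancellation_def by blast
  then show ?thesis unfolding k0_le_def using R(1) by blast
qed

lemma mvn_le_of_k0_le:
  assumes canc: "has_cancellation csc star"
    and P: "is_proj csc star n P" and Q: "is_proj csc star m Q" and le: "k0_le csc star m Q n P"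
  shows "mvn_le Q n P"
proof -
  obtain l R where R: "is_proj csc star l R" and "k0_eq csc star (m + l) (dsum m Q l R) n P"
    using le unfolding k0_le_def by blast
  then have "mvn_A csc star (m + l) (dsum m Q l R) n P"
    using canc is_proj_dsum[OF Q R] P unfolding has_cancellation_def by blast
  then obtain N V where N: "m + l \<le> N" "n \<le> N" and V: "in_A V"
    "mmul csc N (mstar star V) V = dsum m Q l R" "mmul csc N V (mstar star V) = P"
    unfolding mvn_A_def by blast
  define W where "W = mmul csc m V Q"
  have "mmul csc m (dsum m Q l R) Q i j = mmul csc m Q Q i j" for i j
    using is_proj_msupp[OF Q] by (cases "i < m") (simp_all add: mmul_def dsum_eq msupp_iff)
  then have V'W: "mmul csc N (mstar star V) W = Q"
    by (simp add: W_def V(2) is_proj_idem[OF Q] fun_eq_iff flip: mmul_assoc)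
  have "mmul csc n P W = mmul csc N P W"
    using N(2) is_proj_msupp[OF P] by (intro mmul_extend[symmetric]) (auto simp: msupp_iff)
  also have "\<dots> = mmul csc N V Q"
    by (simp add: mmul_assoc V'W flip: V(3))
  also have "\<dots> = W"
    unfolding W_def using N(1) is_proj_msupp[OF Q] by (intro mmul_extend) (auto simp: msupp_iff)
  finally have PW: "mmul csc n P W = W" .
  have "mmul csc n (mstar star W) W = mmul csc N (mstar star W) W"
    using N(2) mmul_eq_self_imp_row_eq_0[OF is_proj_msupp[OF P] PW]
    by (intro mmul_extend[symmetric]) auto
  also have "\<dots> = mmul csc m Q (mmul csc N (mstar star V) W)"
    by (simp add: W_def mstar_mmul is_proj_mstar[OF Q] mmul_assoc)
  also have "\<dots> = Q" by (simp add: V'W is_proj_idem[OF Q])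
  finally have "mmul csc n (mstar star W) W = Q" .
  then show ?thesis
    unfolding mvn_le_def using PW V(1) by (intro exI[of _ W]) (simp add: W_def in_A_mmul)
qed

lemma k0_le_iff_mvn_le:
  assumes "has_cancellation csc star" "is_proj csc star n P" "is_proj csc star m Q"
  shows "k0_le csc star m Q n P \<longleftrightarrow> mvn_le Q n P"
  using k0_le_of_mvn_le[OF assms] mvn_le_of_k0_le[OF assms] by blast

end

section \<open>Singular values of products\<close>

lemma le_mult_cInf_cInf:
  fixes S T :: "real set"
  assumes "S \<noteq> {}" "T \<noteq> {}" and nonneg: "\<And>x. x \<in> S \<Longrightarrow> 0 \<le> x" "\<And>y. y \<in> T \<Longrightarrow> 0 \<le> y"
    and le: "\<And>x y. x \<in> S \<Longrightarrow> y \<in> T \<Longrightarrow> c \<le> x * y"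
  shows "c \<le> Inf S * Inf T"
proof -
  have mult_Inf: "a * Inf A = Inf ((*) a ` A)" if "0 \<le> a" "A \<noteq> {}" "bdd_below A" for a :: real and A
    using that by (intro continuous_at_Inf_mono) (auto intro!: monoI mult_left_mono continuous_intros)
  have bdd: "bdd_below S" "bdd_below T" using nonneg by (meson bdd_belowI)+
  have "0 \<le> Inf T" using \<open>T \<noteq> {}\<close> nonneg(2) by (rule cInf_greatest)
  have "c \<le> x * Inf T" if "x \<in> S" for x
    unfolding mult_Inf[OF nonneg(1)[OF that] \<open>T \<noteq> {}\<close> bdd(2)]
    using \<open>T \<noteq> {}\<close> le that by (intro cInf_greatest) auto
  then show ?thesis
    unfolding mult.commute[of "Inf S"] mult_Inf[OF \<open>0 \<le> Inf T\<close> \<open>S \<noteq> {}\<close> bdd(1)]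
    using \<open>S \<noteq> {}\<close> by (intro cInf_greatest) (auto simp: mult.commute)
qed

context cstar
begin

lemma mvn_le_mat1_0: "mvn_le (mat1 0) n P"
  unfolding mvn_le_def
  by (intro exI[of _ 0]) (auto simp: fun_eq_iff in_A_def mmul_def mat1_def simp flip: zero_prod_def)

lemma ex_proj_norm_mult_le:
  assumes rr: "real_rank_zero csc star" and p: "proj star p" and q: "proj star q" and "\<epsilon> > 0"
  shows "\<exists>r v w. proj star r \<and> r = star v * p * v + star w * q * w \<and>
    norm (a * b - a * b * r) \<le> norm (a - a * p) * norm (b - b * q) + \<epsilon>"
proof -
  define c where "c = p * b - p * b * q"
  have cq: "c * q = 0" by (simp add: c_def left_diff_distrib mult.assoc proj_idem[OF q])
  define C where "C = norm a + norm (a * b) + 1"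
  have C: "C > 0" by (simp add: C_def add_nonneg_pos)
  obtain r t where r: "proj star r" and cr: "norm (c - c * r) \<le> \<epsilon> / C"
    and qr: "norm (q - q * r) \<le> \<epsilon> / C" and t: "star t * (star c * c + q) * t = r"
    using ex_approximate_support[OF rr q cq, of "\<epsilon> / C"] \<open>\<epsilon> > 0\<close> C by auto
  have "p * c = c" by (simp add: c_def right_diff_distrib mult.assoc proj_idem_left[OF p])
  then have "p * (c * t) = c * t" by (simp flip: mult.assoc)
  then have r_eq: "r = star (c * t) * p * (c * t) + star t * q * t"
    by (simp add: t[symmetric] star_mult algebra_simps)
  define x where "x = (a - a * p) * (b - b * q)"
  have "a * b - a * b * r = (x - x * r) + (a * (c - c * r) + a * b * (q - q * r))"
    by (simp add: x_def c_def algebra_simps)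
  also have "norm \<dots> \<le> norm (a - a * p) * norm (b - b * q)
      + (norm a * (\<epsilon> / C) + norm (a * b) * (\<epsilon> / C))"
  proof (intro norm_triangle_mono)
    show "norm (x - x * r) \<le> norm (a - a * p) * norm (b - b * q)"
      unfolding x_def by (rule order_trans[OF norm_diff_proj_right[OF r] norm_mult_ineq])
    show "norm (a * (c - c * r)) \<le> norm a * (\<epsilon> / C)"
      by (rule order_trans[OF norm_mult_ineq mult_left_mono[OF cr norm_ge_zero]])
    show "norm (a * b * (q - q * r)) \<le> norm (a * b) * (\<epsilon> / C)"
      by (rule order_trans[OF norm_mult_ineq mult_left_mono[OF qr norm_ge_zero]])
  qed
  also have "norm a * (\<epsilon> / C) + norm (a * b) * (\<epsilon> / C) = (norm a + norm (a * b)) * (\<epsilon> / C)"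
    by (simp only: distrib_right)
  also have "\<dots> \<le> C * (\<epsilon> / C)"
    using \<open>\<epsilon> > 0\<close> C by (intro mult_right_mono) (auto simp: C_def)
  also have "\<dots> = \<epsilon>" using C by simp
  finally show ?thesis using r r_eq by auto
qed

lemma sval_le:
  assumes "proj star p" "k0_le csc star 1 (mat1 p) n P"
  shows "sval csc star n P a \<le> norm (a - a * p)"
  unfolding sval_def using assms by (intro cInf_lower bdd_belowI[of _ 0]) auto

lemma le_sval_mult_sval:
  assumes canc: "has_cancellation csc star"
    and G: "is_proj csc star n G" and H: "is_proj csc star m H"
    and le: "\<And>p q. proj star p \<Longrightarrow> k0_le csc star 1 (mat1 p) n G \<Longrightarrow>
      proj star q \<Longrightarrow> k0_le csc star 1 (mat1 q) m H \<Longrightarrow> x \<le> norm (a - a * p) * norm (b - b * q)"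
  shows "x \<le> sval csc star n G a * sval csc star m H b"
proof -
  have proj_0: "proj star 0" by (simp add: proj_def star.zero)
  have "k0_le csc star 1 (mat1 0) n G" "k0_le csc star 1 (mat1 0) m H"
    using k0_le_iff_mvn_le[OF canc _ is_proj_mat1[OF proj_0]] G H mvn_le_mat1_0 by blast+
  then show ?thesis
    unfolding sval_def
  proof (intro le_mult_cInf_cInf)
    let ?S = "\<lambda>k R y. {norm (y - y * p) |p. proj star p \<and> k0_le csc star 1 (mat1 p) k R}"
    show "?S n G a \<noteq> {}" "?S m H b \<noteq> {}"
      using proj_0 \<open>k0_le csc star 1 (mat1 0) n G\<close> \<open>k0_le csc star 1 (mat1 0) m H\<close> by blast+
    show "x \<le> \<alpha> * \<beta>" if "\<alpha> \<in> ?S n G a" "\<beta> \<in> ?S m H b" for \<alpha> \<beta>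
      using that le by blast
  qed auto
qed

lemma sval_dsum_mult_le_norm_mult:
  assumes rr: "real_rank_zero csc star" and canc: "has_cancellation csc star"
    and G: "is_proj csc star n G" and H: "is_proj csc star m H"
    and p: "proj star p" "k0_le csc star 1 (mat1 p) n G"
    and q: "proj star q" "k0_le csc star 1 (mat1 q) m H"
  shows "sval csc star (n + m) (dsum n G m H) (a * b) \<le> norm (a - a * p) * norm (b - b * q)"
proof (rule field_le_epsilon)
  fix \<epsilon> :: real assume "\<epsilon> > 0"
  then obtain r v w where r: "proj star r" "r = star v * p * v + star w * q * w"
    and le: "norm (a * b - a * b * r) \<le> norm (a - a * p) * norm (b - b * q) + \<epsilon>"
    using ex_proj_norm_mult_le[OF rr p(1) q(1)] by blast
  have "mvn_le (mat1 p) n G" "mvn_le (mat1 q) m H"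
    using p q k0_le_iff_mvn_le[OF canc G is_proj_mat1] k0_le_iff_mvn_le[OF canc H is_proj_mat1]
    by blast+
  then have "mvn_le (mat1 r) (n + m) (dsum n G m H)"
    unfolding r(2) mat1_add[symmetric] by (intro mvn_le_dsum mvn_le_mat1_compress)
  then have "k0_le csc star 1 (mat1 r) (n + m) (dsum n G m H)"
    using k0_le_iff_mvn_le[OF canc is_proj_dsum[OF G H] is_proj_mat1[OF r(1)]] by blast
  then show "sval csc star (n + m) (dsum n G m H) (a * b)
      \<le> norm (a - a * p) * norm (b - b * q) + \<epsilon>"
    using sval_le[OF r(1)] le by (meson order_trans)
qed

end

theorem theorem3p16:
  fixes csc :: "complex \<Rightarrow> 'a::{real_normed_algebra,banach} \<Rightarrow> 'a"
    and star :: "'a \<Rightarrow> 'a"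
  assumes "cstar_algebra csc star"
    and "has_cancellation csc star"
    and "real_rank_zero csc star"
    and "k0pos_eq_D0 csc star"
  shows "\<forall>a b n G m H. is_proj csc star n G \<longrightarrow> is_proj csc star m H \<longrightarrow>
           sval csc star (n + m) (dsum n G m H) (a * b)
             \<le> sval csc star n G a * sval csc star m H b"
proof (intro allI impI)
  interpret cstar csc star by unfold_locales (rule assms(1))
  fix a b n G m H
  assume G: "is_proj csc star n G" and H: "is_proj csc star m H"
  show "sval csc star (n + m) (dsum n G m H) (a * b) \<le> sval csc star n G a * sval csc star m H b"
    by (rule le_sval_mult_sval[OF assms(2) G H])
      (rule sval_dsum_mult_le_norm_mult[OF assms(3,2) G H])
qed

end
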